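(* Let $\pi$ be a non-empty set of primes, let $\mathfrak{F}=\mathfrak{F}_{\pi'}$ be the class of all finite $\pi'$-groups, and let $G$ be a finite group. If every maximal chain of $G$ of length $3$ includes a proper $K$-$\mathfrak{F}$-subnormal subgroup of $G$, then $G$ is $\pi$-soluble.
   Context: All groups are finite. $\pi'$ is the set of all primes not in $\pi$; a $\pi'$-group is a group whose order is divisible by no prime in $\pi$. For subgroups $B\le A$, $B_A$ denotes the normal core of $B$ in $A$ (the largest normal subgroup of $A$ contained in $B$). A subgroup $A$ of $G$ is $K$-$\mathfrak{F}$-subnormal in $G$ if there is a chain of subgroups $A=A_0\le A_1\le\cdots\le A_n=G$ such that for each $i=1,\ldots,n$ either $A_{i-1}\trianglelefteq A_i$ or $A_i/(A_{i-1})_{A_i}\in\mathfrak{F}$. A maximal chain of $G$ of length $n$ is a chain $M_n<M_{n-1}<\cdots<M_1<M_0=G$ where $M_i$ is a maximal subgroup of $M_{i-1}$ for all $i=1,\ldots,n$. It includes a proper $K$-$\mathfrak{F}$-subnormal subgroup if some $M_i$ with $i\ge 1$ is $K$-$\mathfrak{F}$-subnormal in $G$. $G$ is $\pi$-soluble if every chief factor of $G$ is either a $p$-group for some $p\in\pi$ or a $\pi'$-group. *)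

theory Defs
  imports "HOL-Algebra.Algebra"
begin

text \<open>Subgroups are carrier sets: a subgroup \<open>A\<close> of \<open>G\<close>, regarded as a group in its
  own right, is \<open>G\<lparr>carrier := A\<rparr>\<close>. A class of groups is a set of \<open>'b monoid\<close>, and
  a quotient of a group over \<open>'a\<close> has its elements in \<open>'a set\<close>.\<close>

text \<open>The class of finite \<open>\<pi>'\<close>-groups. The qualified name selects primality of numbers rather
  than the \<open>prime\<close> of \<open>HOL-Algebra.Divisibility\<close>.\<close>

definition pi_prime_groups :: "nat set \<Rightarrow> 'b monoid set" where
  "pi_prime_groups \<pi> =
     {H. group H \<and> finite (carrier H) \<and> (\<forall>p\<in>\<pi>. Factorial_Ring.prime p \<longrightarrow> \<not> p dvd order H)}"

definition is_p_group :: "nat \<Rightarrow> 'b monoid \<Rightarrow> bool" where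
  "is_p_group p H \<longleftrightarrow> group H \<and> (\<exists>k. order H = p ^ k)"

text \<open>\<open>Greatest\<close> refers to inclusion of sets; \<open>normal_core_greatest\<close> below shows
  that the greatest element exists.\<close>

definition normal_core :: "('a, 'b) monoid_scheme \<Rightarrow> 'a set \<Rightarrow> 'a set" where
  "normal_core A B = (GREATEST N. N \<lhd> A \<and> N \<subseteq> B)"

lemma (in group) normal_core_greatest:
  assumes B: "subgroup B G"
  shows "normal_core G B \<lhd> G" and "normal_core G B \<subseteq> B"
    and "\<And>N. N \<lhd> G \<Longrightarrow> N \<subseteq> B \<Longrightarrow> N \<subseteq> normal_core G B"
proof -
  define C where "C = {h \<in> carrier G. \<forall>x\<in>carrier G. x \<otimes> h \<otimes> inv x \<in> B}"
  have sub: "C \<subseteq> B"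
  proof
    fix h assume "h \<in> C"
    then have "h \<in> carrier G" "\<one> \<otimes> h \<otimes> inv \<one> \<in> B"
      unfolding C_def by blast+
    then show "h \<in> B" by simp
  qed
  have sg: "subgroup C G"
  proof (rule subgroupI)
    show "C \<subseteq> carrier G" by (auto simp: C_def)
    have "\<one> \<in> C" using subgroup.one_closed[OF B] by (auto simp: C_def)
    then show "C \<noteq> {}" by blast
  next
    fix a assume a: "a \<in> C"
    have "x \<otimes> inv a \<otimes> inv x \<in> B" if x: "x \<in> carrier G" for x
    proof -
      have "a \<in> carrier G" "x \<otimes> a \<otimes> inv x \<in> B" using a x by (auto simp: C_def)
      moreover from this have "inv (x \<otimes> a \<otimes> inv x) = x \<otimes> inv a \<otimes> inv x"
        using x by (simp add: inv_mult_group m_assoc)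
      ultimately show ?thesis using subgroup.m_inv_closed[OF B] by metis
    qed
    then show "inv a \<in> C" using a by (auto simp: C_def)
  next
    fix a b assume ab: "a \<in> C" "b \<in> C"
    have "x \<otimes> (a \<otimes> b) \<otimes> inv x \<in> B" if x: "x \<in> carrier G" for x
    proof -
      have c: "a \<in> carrier G" "b \<in> carrier G" using ab by (auto simp: C_def)
      have "(x \<otimes> a \<otimes> inv x) \<otimes> (x \<otimes> b \<otimes> inv x) \<in> B"
        using ab x subgroup.m_closed[OF B] by (auto simp: C_def)
      moreover have "inv x \<otimes> (x \<otimes> (b \<otimes> inv x)) = b \<otimes> inv x"
        using x c by (simp add: m_assoc[symmetric])
      then have "(x \<otimes> a \<otimes> inv x) \<otimes> (x \<otimes> b \<otimes> inv x) = x \<otimes> (a \<otimes> b) \<otimes> inv x"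
        using x c by (simp add: m_assoc)
      ultimately show ?thesis by simp
    qed
    then show "a \<otimes> b \<in> C" using ab by (auto simp: C_def)
  qed
  have nor: "C \<lhd> G"
    unfolding normal_inv_iff
  proof (intro conjI sg ballI)
    fix x h assume x: "x \<in> carrier G" and h: "h \<in> C"
    then have hc: "h \<in> carrier G" by (auto simp: C_def)
    have "y \<otimes> (x \<otimes> h \<otimes> inv x) \<otimes> inv y \<in> B" if y: "y \<in> carrier G" for y
    proof -
      have "y \<otimes> x \<in> carrier G" using x y by simp
      then have "(y \<otimes> x) \<otimes> h \<otimes> inv (y \<otimes> x) \<in> B" using h unfolding C_def by blast
      then show ?thesis using x y hc by (simp add: inv_mult_group m_assoc)
    qed
    then show "x \<otimes> h \<otimes> inv x \<in> C" using x hc by (auto simp: C_def)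
  qed
  have mx: "N \<subseteq> C" if N: "N \<lhd> G" "N \<subseteq> B" for N
    using normal.inv_op_closed2[OF N(1)] normal_imp_subgroup[OF N(1), THEN subgroup.subset] N(2)
    unfolding C_def by blast
  have "normal_core G B = C"
    unfolding normal_core_def by (rule Greatest_equality) (use nor sub mx in auto)
  then show "normal_core G B \<lhd> G" "normal_core G B \<subseteq> B"
    "\<And>N. N \<lhd> G \<Longrightarrow> N \<subseteq> B \<Longrightarrow> N \<subseteq> normal_core G B"
    using nor sub mx by auto
qed

definition K_subnormal ::
    "'a set monoid set \<Rightarrow> ('a, 'b) monoid_scheme \<Rightarrow> 'a set \<Rightarrow> bool" where
  "K_subnormal \<FF> G A \<longleftrightarrow>
     (\<exists>(n::nat) C. C 0 = A \<and> C n = carrier G \<and>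
        (\<forall>i\<le>n. subgroup (C i) G) \<and>
        (\<forall>i<n. C i \<subseteq> C (Suc i) \<and>
           (C i \<lhd> G\<lparr>carrier := C (Suc i)\<rparr> \<or>
            G\<lparr>carrier := C (Suc i)\<rparr> Mod normal_core (G\<lparr>carrier := C (Suc i)\<rparr>) (C i) \<in> \<FF>)))"

definition maximal_subgroup :: "('a, 'b) monoid_scheme \<Rightarrow> 'a set \<Rightarrow> bool" where
  "maximal_subgroup G M \<longleftrightarrow>
     subgroup M G \<and> M \<noteq> carrier G \<and>
     (\<forall>L. subgroup L G \<longrightarrow> M \<subseteq> L \<longrightarrow> L = M \<or> L = carrier G)"

text \<open>Only the values \<open>M 0, \<dots>, M n\<close> matter.\<close>

definition maximal_chain ::
    "('a, 'b) monoid_scheme \<Rightarrow> nat \<Rightarrow> (nat \<Rightarrow> 'a set) \<Rightarrow> bool" where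
  "maximal_chain G n M \<longleftrightarrow>
     M 0 = carrier G \<and>
     (\<forall>i\<in>{1..n}. maximal_subgroup (G\<lparr>carrier := M (i - 1)\<rparr>) (M i))"

text \<open>\<open>H / K\<close> is a chief factor of \<open>G\<close>.\<close>

definition chief_factor :: "('a, 'b) monoid_scheme \<Rightarrow> 'a set \<Rightarrow> 'a set \<Rightarrow> bool" where
  "chief_factor G H K \<longleftrightarrow>
     H \<lhd> G \<and> K \<lhd> G \<and> K \<subset> H \<and> (\<nexists>L. L \<lhd> G \<and> K \<subset> L \<and> L \<subset> H)"

definition pi_soluble :: "nat set \<Rightarrow> ('a, 'b) monoid_scheme \<Rightarrow> bool" where
  "pi_soluble \<pi> G \<longleftrightarrow>
     (\<forall>H K. chief_factor G H K \<longrightarrow>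
        (\<exists>p\<in>\<pi>. is_p_group p (G\<lparr>carrier := H\<rparr> Mod K)) \<or>
        G\<lparr>carrier := H\<rparr> Mod K \<in> pi_prime_groups \<pi>)"

end

theory Submission
  imports Defs
begin

text \<open>Let \<open>H / K\<close> be a chief factor whose order is divisible by some \<open>p \<in> \<pi>\<close>. It has to be shown
  that it is a \<open>p\<close>-group, and for this it is enough that it is abelian: then its Sylow
  \<open>p\<close>-subgroup is normal, and a proper normal subgroup of a chief factor cannot have an index prime
  to \<open>p\<close> if \<open>p\<close> divides the order of the factor (\<open>chief_factor_normal_prime_index\<close>).

  For the same reason, the \<open>\<pi>'\<close>-quotients in a \<open>K\<close>-\<open>\<FF>\<close>-subnormal chain are harmless: if
  \<open>A \<supseteq> K\<close> is \<open>K\<close>-\<open>\<FF>\<close>-subnormal and does not contain \<open>H\<close>, then \<open>A \<inter> H\<close> lies in a proper normal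
  subgroup of \<open>H\<close> (\<open>K_subnormal_trace\<close>). Pass to \<open>G / K\<close>, written \<open>G\<close> again, and let \<open>N\<close> be the
  image of \<open>H\<close>, a minimal normal subgroup. The hypothesis now says that whenever \<open>M1\<close>
  is a maximal subgroup that does not contain \<open>N\<close>, the trace on \<open>N\<close> of a subgroup two steps
  below \<open>M1\<close> lies in a proper normal subgroup of \<open>N\<close>.

  If \<open>N = G\<close>, then \<open>G\<close> is simple and every chain \<open>{\<one>} < A < B < C < G\<close> of subgroups is excluded.
  If \<open>N\<close> is proper and not abelian, then \<open>N\<close> is the direct product of a simple group \<open>S\<close> and its
  centralizer, and the maximal subgroups above the normalizer of a Sylow subgroup \<open>P\<close> of \<open>N\<close> do
  not contain \<open>N\<close>. As \<open>P\<close> has normal closure \<open>N\<close> in \<open>N\<close>, very little room is left around it, and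
  \<open>P \<inter> S\<close> turns out to be of prime order and self-normalizing in \<open>S\<close>.

  In both cases a simple group contains a nontrivial proper abelian subgroup that is
  self-normalizing and meets its other conjugates trivially. The transfer is a retraction
  onto such a subgroup, so its kernel contradicts simplicity
  (\<open>abelian_TI_subgroup_imp_normal_subgroup\<close>). In the first case this subgroup is the normalizer of a
  subgroup whose order is the least prime factor of the group order.\<close>

section \<open>Subgroups, conjugation and centralizers\<close>

lemma (in group) mult_inv_cancel_left:
  "x \<in> carrier G \<Longrightarrow> y \<in> carrier G \<Longrightarrow> x \<otimes> (inv x \<otimes> y) = y"
  by (simp add: m_assoc[symmetric])

lemma (in group) inv_mult_cancel_left:
  "x \<in> carrier G \<Longrightarrow> y \<in> carrier G \<Longrightarrow> inv x \<otimes> (x \<otimes> y) = y"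
  by (simp add: m_assoc[symmetric])

lemma (in group) conj_mult:
  "g \<in> carrier G \<Longrightarrow> x \<in> carrier G \<Longrightarrow> y \<in> carrier G \<Longrightarrow>
    g \<otimes> (x \<otimes> y) \<otimes> inv g = (g \<otimes> x \<otimes> inv g) \<otimes> (g \<otimes> y \<otimes> inv g)"
  by (simp add: m_assoc inv_mult_cancel_left)

lemma (in group) conj_inv:
  "g \<in> carrier G \<Longrightarrow> x \<in> carrier G \<Longrightarrow> g \<otimes> inv x \<otimes> inv g = inv (g \<otimes> x \<otimes> inv g)"
  by (simp add: m_assoc inv_mult_group)

lemma (in group) conj_conj:
  "g \<in> carrier G \<Longrightarrow> h \<in> carrier G \<Longrightarrow> x \<in> carrier G \<Longrightarrow>
    g \<otimes> (h \<otimes> x \<otimes> inv h) \<otimes> inv g = (g \<otimes> h) \<otimes> x \<otimes> inv (g \<otimes> h)"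
  by (simp add: m_assoc inv_mult_group)

lemma (in group) conj_fixed_iff:
  "g \<in> carrier G \<Longrightarrow> x \<in> carrier G \<Longrightarrow> g \<otimes> x \<otimes> inv g = x \<longleftrightarrow> g \<otimes> x = x \<otimes> g"
  by (metis inv_solve_right m_closed)

lemma (in group) conj_eq_one_iff:
  assumes "g \<in> carrier G" "x \<in> carrier G"
  shows "g \<otimes> x \<otimes> inv g = \<one> \<longleftrightarrow> x = \<one>"
proof
  assume "g \<otimes> x \<otimes> inv g = \<one>"
  then have "inv g \<otimes> (g \<otimes> x \<otimes> inv g) \<otimes> g = inv g \<otimes> \<one> \<otimes> g" by simp
  then show "x = \<one>" using assms by (simp add: m_assoc inv_mult_cancel_left)
qed (use assms in simp)

lemma (in group) card_conjugate:
  assumes "g \<in> carrier G" "P \<subseteq> carrier G"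
  shows "card ((\<lambda>x. g \<otimes> x \<otimes> inv g) ` P) = card P"
proof (rule card_image)
  show "inj_on (\<lambda>x. g \<otimes> x \<otimes> inv g) P"
  proof (rule inj_onI)
    fix x y assume "x \<in> P" "y \<in> P" and eq: "g \<otimes> x \<otimes> inv g = g \<otimes> y \<otimes> inv g"
    then have "x \<in> carrier G" "y \<in> carrier G" using assms by auto
    then show "x = y" using eq assms(1) by simp
  qed
qed

lemma (in group) normal_in_iff:
  assumes "subgroup N G"
  shows "L \<lhd> G\<lparr>carrier := N\<rparr> \<longleftrightarrow>
    subgroup L G \<and> L \<subseteq> N \<and> (\<forall>x\<in>N. \<forall>l\<in>L. x \<otimes> l \<otimes> inv x \<in> L)"
proof -
  interpret N: group "G\<lparr>carrier := N\<rparr>" using assms by (rule subgroup_imp_group)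
  have "subgroup L (G\<lparr>carrier := N\<rparr>) \<longleftrightarrow> subgroup L G \<and> L \<subseteq> N"
    using incl_subgroup[OF assms] subgroup_incl[OF _ assms] subgroup.subset[of L "G\<lparr>carrier := N\<rparr>"] by auto
  then show ?thesis
    using m_inv_consistent[OF assms] by (auto simp: N.normal_inv_iff)
qed

lemma (in group) maximal_in_iff:
  assumes "subgroup B G"
  shows "maximal_subgroup (G\<lparr>carrier := B\<rparr>) M \<longleftrightarrow>
    subgroup M G \<and> M \<subset> B \<and> (\<forall>L. subgroup L G \<longrightarrow> M \<subseteq> L \<longrightarrow> L \<subseteq> B \<longrightarrow> L = M \<or> L = B)"
proof -
  have "subgroup L (G\<lparr>carrier := B\<rparr>) \<longleftrightarrow> subgroup L G \<and> L \<subseteq> B" for L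
    using incl_subgroup[OF assms] subgroup_incl[OF _ assms] subgroup.subset[of L "G\<lparr>carrier := B\<rparr>"] by auto
  then show ?thesis by (auto simp: maximal_subgroup_def)
qed

lemma (in group) card_subgroup_dvd:
  assumes "subgroup A G" "subgroup B G" "A \<subseteq> B"
  shows "card A dvd card B"
proof -
  interpret B: group "G\<lparr>carrier := B\<rparr>" using assms(2) by (rule subgroup_imp_group)
  have "subgroup A (G\<lparr>carrier := B\<rparr>)" using assms by (simp add: subgroup_incl)
  from B.lagrange[OF this] show ?thesis by (simp add: order_def dvd_def mult.commute) (metis mult.commute)
qed

lemma (in group) exists_maximal_above:
  assumes "finite (carrier G)" "subgroup A G" "subgroup B G" "A \<subset> B"
  shows "\<exists>M. maximal_subgroup (G\<lparr>carrier := B\<rparr>) M \<and> A \<subseteq> M"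
proof -
  define F where "F = {Y. subgroup Y G \<and> A \<subseteq> Y \<and> Y \<subset> B}"
  have "F \<subseteq> Pow (carrier G)" using subgroup.subset by (auto simp: F_def)
  then have "finite F" using assms(1) by (meson finite_Pow_iff finite_subset)
  moreover have "A \<in> F" using assms by (auto simp: F_def)
  ultimately have "\<exists>M\<in>F. A \<subseteq> M \<and> (\<forall>Y\<in>F. M \<subseteq> Y \<longrightarrow> M = Y)"
    by (rule finite_has_maximal2)
  then obtain M where M: "M \<in> F" "A \<subseteq> M" "\<forall>Y\<in>F. M \<subseteq> Y \<longrightarrow> M = Y" by auto
  have "L = M \<or> L = B" if L: "subgroup L G" "M \<subseteq> L" "L \<subseteq> B" for L
  proof (rule ccontr)
    assume ne: "\<not> (L = M \<or> L = B)"
    then have "L \<in> F" using L M(2) by (auto simp: F_def)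
    then show False using M(3) L(2) ne by blast
  qed
  then have "maximal_subgroup (G\<lparr>carrier := B\<rparr>) M"
    using M(1) unfolding maximal_in_iff[OF assms(3)] by (simp add: F_def)
  then show ?thesis using M(2) by (intro exI conjI)
qed

lemma (in group) maximal_chain_through:
  assumes fin: "finite (carrier G)" and M1: "maximal_subgroup G M1"
    and U: "subgroup U G" and Y: "subgroup Y G" and UY: "U \<subset> Y" and YM: "Y \<subset> M1"
  obtains M where "maximal_chain G 3 M" "M 1 = M1" "U \<subseteq> M 3"
proof -
  have M1s: "subgroup M1 G" using M1 by (simp add: maximal_subgroup_def)
  obtain M2 where M2: "maximal_subgroup (G\<lparr>carrier := M1\<rparr>) M2" "Y \<subseteq> M2"
    using exists_maximal_above[OF fin Y M1s YM] by blast
  have M2s: "subgroup M2 G" using M2(1) maximal_in_iff[OF M1s] by blast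
  obtain M3 where M3: "maximal_subgroup (G\<lparr>carrier := M2\<rparr>) M3" "U \<subseteq> M3"
    using exists_maximal_above[OF fin U M2s] UY M2(2) by blast
  define M where "M = (\<lambda>i::nat. if i = 0 then carrier G else if i = 1 then M1 else if i = 2 then M2 else M3)"
  have "maximal_chain G 3 M"
    unfolding maximal_chain_def
  proof (intro conjI ballI)
    show "maximal_subgroup (G\<lparr>carrier := M (i - 1)\<rparr>) (M i)" if "i \<in> {1..3}" for i
    proof -
      have "i = 1 \<or> i = 2 \<or> i = 3" using that by auto
      then show ?thesis using M1 M2 M3 by (auto simp: M_def)
    qed
  qed (simp add: M_def)
  then show ?thesis using that[of M] M3 by (simp add: M_def)
qed

lemma maximal_chain_antimono:
  assumes "maximal_chain G n M" "i \<le> j" "j \<le> n"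
  shows "M j \<subseteq> M i"
  using assms(2,3)
proof (induction j rule: dec_induct)
  case (step k)
  have "maximal_subgroup (G\<lparr>carrier := M k\<rparr>) (M (Suc k))"
    using assms(1) step.prems unfolding maximal_chain_def
    by (metis One_nat_def atLeastAtMost_iff diff_Suc_1 le_add1 plus_1_eq_Suc)
  then have "M (Suc k) \<subseteq> M k" using subgroup.subset by (fastforce simp: maximal_subgroup_def)
  then show ?case using step by simp
qed simp

lemma (in group) subgroup_conj_vimage:
  assumes g: "g \<in> carrier G" and A: "subgroup A G" and B: "subgroup B G"
  shows "subgroup {x \<in> A. g \<otimes> x \<otimes> inv g \<in> B} G"
proof -
  interpret A: subgroup A G by (rule A)
  interpret B: subgroup B G by (rule B)
  show ?thesis
  proof (rule subgroupI)
    have "\<one> \<in> {x \<in> A. g \<otimes> x \<otimes> inv g \<in> B}" using g by simp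
    then show "{x \<in> A. g \<otimes> x \<otimes> inv g \<in> B} \<noteq> {}" by blast
  qed (use g in \<open>auto simp: conj_mult conj_inv\<close>)
qed

lemma (in group) subgroup_conj_image:
  assumes g: "g \<in> carrier G" and A: "subgroup A G"
  shows "subgroup ((\<lambda>x. g \<otimes> x \<otimes> inv g) ` A) G"
proof -
  interpret A: subgroup A G by (rule A)
  show ?thesis
  proof (rule subgroupI)
    show "(\<lambda>x. g \<otimes> x \<otimes> inv g) ` A \<noteq> {}" using A.one_closed by blast
  next
    fix a assume "a \<in> (\<lambda>x. g \<otimes> x \<otimes> inv g) ` A"
    then show "inv a \<in> (\<lambda>x. g \<otimes> x \<otimes> inv g) ` A" using g by (auto simp: conj_inv[symmetric])
  next
    fix a b assume "a \<in> (\<lambda>x. g \<otimes> x \<otimes> inv g) ` A" "b \<in> (\<lambda>x. g \<otimes> x \<otimes> inv g) ` A"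
    then show "a \<otimes> b \<in> (\<lambda>x. g \<otimes> x \<otimes> inv g) ` A" using g by (auto simp: conj_mult[symmetric])
  qed (use g in auto)
qed

definition centralizer :: "('a, 'b) monoid_scheme \<Rightarrow> 'a set \<Rightarrow> 'a set" where
  "centralizer G Y = {g \<in> carrier G. \<forall>y\<in>Y. g \<otimes>\<^bsub>G\<^esub> y = y \<otimes>\<^bsub>G\<^esub> g}"

lemma (in group) subgroup_centralizer:
  assumes Y: "Y \<subseteq> carrier G"
  shows "subgroup (centralizer G Y) G"
proof -
  have eq: "centralizer G Y = {g \<in> carrier G. \<forall>y\<in>Y. g \<otimes> y \<otimes> inv g = y}"
  proof -
    have "g \<otimes> y \<otimes> inv g = y \<longleftrightarrow> g \<otimes> y = y \<otimes> g" if "g \<in> carrier G" "y \<in> Y" for g y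
      using that Y conj_fixed_iff by blast
    then show ?thesis by (auto simp: centralizer_def)
  qed
  show ?thesis
  proof (rule subgroupI)
    have "\<one> \<in> centralizer G Y" using Y by (auto simp: centralizer_def)
    then show "centralizer G Y \<noteq> {}" by blast
  next
    fix a assume a: "a \<in> centralizer G Y"
    have "inv a \<otimes> y = y \<otimes> inv a" if y: "y \<in> Y" for y
    proof -
      have c: "a \<in> carrier G" "y \<in> carrier G" "a \<otimes> y = y \<otimes> a" using a y Y by (auto simp: centralizer_def)
      have "inv a \<otimes> (y \<otimes> a) \<otimes> inv a = inv a \<otimes> (a \<otimes> y) \<otimes> inv a" using c by simp
      then show ?thesis using c(1,2) by (simp add: m_assoc inv_mult_cancel_left)
    qed
    then show "inv a \<in> centralizer G Y" using a by (simp add: centralizer_def)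
  next
    fix a b assume "a \<in> centralizer G Y" "b \<in> centralizer G Y"
    then show "a \<otimes> b \<in> centralizer G Y" unfolding eq using Y by (auto simp: conj_conj[symmetric])
  qed (auto simp: centralizer_def)
qed

lemma (in group) conj_in_centralizer:
  assumes g: "g \<in> carrier G" and Y: "Y \<subseteq> carrier G"
    and inv: "\<And>y. y \<in> Y \<Longrightarrow> inv g \<otimes> y \<otimes> g \<in> Y" and c: "c \<in> centralizer G Y"
  shows "g \<otimes> c \<otimes> inv g \<in> centralizer G Y"
proof -
  have cc: "c \<in> carrier G" using c by (simp add: centralizer_def)
  have "(g \<otimes> c \<otimes> inv g) \<otimes> y = y \<otimes> (g \<otimes> c \<otimes> inv g)" if y: "y \<in> Y" for y
  proof -
    have yc: "y \<in> carrier G" using y Y by blast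
    have com: "c \<otimes> (inv g \<otimes> y \<otimes> g) = (inv g \<otimes> y \<otimes> g) \<otimes> c"
      using c inv[OF y] by (simp add: centralizer_def)
    have "(g \<otimes> c \<otimes> inv g) \<otimes> y = g \<otimes> (c \<otimes> (inv g \<otimes> y \<otimes> g)) \<otimes> inv g"
      using g cc yc by (simp add: m_assoc)
    also have "\<dots> = y \<otimes> (g \<otimes> c \<otimes> inv g)"
      unfolding com using g cc yc by (simp add: m_assoc mult_inv_cancel_left)
    finally show ?thesis .
  qed
  then show ?thesis using g cc by (simp add: centralizer_def)
qed

lemma (in group) normal_centralizer_in:
  assumes N: "subgroup N G" and L: "L \<lhd> G\<lparr>carrier := N\<rparr>"
  shows "N \<inter> centralizer G L \<lhd> G\<lparr>carrier := N\<rparr>"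
proof -
  interpret N: subgroup N G by (rule N)
  note l = L[unfolded normal_in_iff[OF N]]
  have Lc: "L \<subseteq> carrier G" using l N.subset by blast
  have "x \<otimes> c \<otimes> inv x \<in> centralizer G L" if x: "x \<in> N" and c: "c \<in> centralizer G L" for x c
  proof (rule conj_in_centralizer[OF _ Lc _ c])
    show "inv x \<otimes> y \<otimes> x \<in> L" if "y \<in> L" for y
      using l N.m_inv_closed[OF x] that x by (metis N.mem_carrier inv_inv)
  qed (use x in simp)
  moreover have "subgroup (N \<inter> centralizer G L) G"
    using subgroups_Inter_pair[OF N subgroup_centralizer[OF Lc]] .
  ultimately show ?thesis
    unfolding normal_in_iff[OF N] by (auto simp: centralizer_def)
qed

text \<open>In a finite group it suffices that conjugation maps \<open>P\<close> into itself.\<close>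

lemma (in group) mem_normalizer_iff:
  assumes fin: "finite (carrier G)" and P: "P \<subseteq> carrier G"
  shows "g \<in> normalizer G P \<longleftrightarrow> g \<in> carrier G \<and> (\<forall>x\<in>P. g \<otimes> x \<otimes> inv g \<in> P)"
proof -
  have img: "g <# P #> inv g = (\<lambda>x. g \<otimes> x \<otimes> inv g) ` P"
    by (auto simp: l_coset_def r_coset_def)
  have "(\<lambda>x. g \<otimes> x \<otimes> inv g) ` P = P \<longleftrightarrow> (\<forall>x\<in>P. g \<otimes> x \<otimes> inv g \<in> P)" if g: "g \<in> carrier G"
  proof
    assume "\<forall>x\<in>P. g \<otimes> x \<otimes> inv g \<in> P"
    then show "(\<lambda>x. g \<otimes> x \<otimes> inv g) ` P = P"
      using card_conjugate[OF g P] fin P by (intro card_subset_eq) (auto intro: finite_subset)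
  qed blast
  then show ?thesis
    using P by (auto simp: normalizer_def stabilizer_def img)
qed

lemma (in group) normalizer_superset:
  assumes fin: "finite (carrier G)" and P: "subgroup P G"
  shows "subgroup (normalizer G P) G" "P \<subseteq> normalizer G P"
    and "normalizer G P = carrier G \<Longrightarrow> P \<lhd> G"
proof -
  interpret P: subgroup P G by (rule P)
  show "subgroup (normalizer G P) G" by (rule normalizer_imp_subgroup[OF P.subset])
  show "P \<subseteq> normalizer G P" using mem_normalizer_iff[OF fin P.subset] by auto
  show "P \<lhd> G" if "normalizer G P = carrier G"
    using that mem_normalizer_iff[OF fin P.subset] P by (auto intro!: normal_invI)
qed

lemma (in group) prime_card_subgroup_eq:
  assumes P: "subgroup P G" "Factorial_Ring.prime (card P)"
    and I: "subgroup I G" "I \<subseteq> P" and a: "a \<in> I" "a \<noteq> \<one>"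
  shows "I = P"
proof -
  have fin: "finite P" using P(2) by (metis card.infinite not_prime_0)
  have "card I dvd card P" by (rule card_subgroup_dvd[OF I(1) P(1) I(2)])
  moreover have "card I \<noteq> 1"
    using a subgroup.one_closed[OF I(1)] by (metis card_1_singletonE singletonD)
  ultimately have "card I = card P" using P(2) by (auto simp: prime_nat_iff)
  then show ?thesis using card_subset_eq[OF fin I(2)] by simp
qed

lemma (in group) prime_card_subgroup_commute:
  assumes P: "subgroup P G" "Factorial_Ring.prime (card P)" and ab: "a \<in> P" "b \<in> P"
  shows "a \<otimes> b = b \<otimes> a"
proof (cases "a = \<one>")
  case True then show ?thesis using ab subgroup.mem_carrier[OF P(1)] by simp
next
  case False
  have aG: "a \<in> carrier G" using ab subgroup.mem_carrier[OF P(1)] by simp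
  have "P \<inter> centralizer G {a} = P"
  proof (rule prime_card_subgroup_eq[OF P _ _ _ False])
    show "subgroup (P \<inter> centralizer G {a}) G"
      using subgroups_Inter_pair[OF P(1) subgroup_centralizer] aG by simp
  qed (use ab aG in \<open>auto simp: centralizer_def\<close>)
  then have "b \<in> centralizer G {a}" using ab(2) by blast
  then show ?thesis by (simp add: centralizer_def)
qed

lemma (in group) prime_card_subgroup_conj:
  assumes P: "subgroup P G" "Factorial_Ring.prime (card P)" and g: "g \<in> carrier G"
    and a: "a \<in> P" "a \<noteq> \<one>" "g \<otimes> a \<otimes> inv g \<in> P" and x: "x \<in> P"
  shows "g \<otimes> x \<otimes> inv g \<in> P"
proof -
  have "{x \<in> P. g \<otimes> x \<otimes> inv g \<in> P} = P"
    by (rule prime_card_subgroup_eq[OF P subgroup_conj_vimage[OF g P(1) P(1)], of a]) (use a in auto)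
  then show ?thesis using x by blast
qed

lemma (in group) commuting_set_mult:
  assumes S: "subgroup S G" and C: "subgroup C G"
    and com: "\<And>s c. s \<in> S \<Longrightarrow> c \<in> C \<Longrightarrow> s \<otimes> c = c \<otimes> s"
  shows subgroup_commuting_set_mult: "subgroup (S <#> C) G"
    and commuting_set_mult_subset: "S \<subseteq> S <#> C" "C \<subseteq> S <#> C"
    and card_commuting_set_mult: "S \<inter> C = {\<one>} \<Longrightarrow> card (S <#> C) = card S * card C"
proof -
  interpret S: subgroup S G by (rule S)
  interpret C: subgroup C G by (rule C)
  show "S \<subseteq> S <#> C"
  proof
    fix s assume s: "s \<in> S"
    then have "s \<otimes> \<one> \<in> S <#> C" unfolding set_mult_def using C.one_closed by blast
    then show "s \<in> S <#> C" using s by simp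
  qed
  show "C \<subseteq> S <#> C"
  proof
    fix c assume c: "c \<in> C"
    then have "\<one> \<otimes> c \<in> S <#> C" unfolding set_mult_def using S.one_closed by blast
    then show "c \<in> S <#> C" using c by simp
  qed
  show "subgroup (S <#> C) G"
  proof (rule subgroupI)
    show "S <#> C \<subseteq> carrier G" by (rule setmult_subset_G[OF S.subset C.subset])
    show "S <#> C \<noteq> {}" using S.one_closed C.one_closed unfolding set_mult_def by blast
  next
    fix a assume "a \<in> S <#> C"
    then obtain s c where sc: "s \<in> S" "c \<in> C" "a = s \<otimes> c" by (auto simp: set_mult_def)
    then have "inv a = inv s \<otimes> inv c" using com[of "inv s" "inv c"] by (simp add: inv_mult_group)
    then show "inv a \<in> S <#> C" using sc unfolding set_mult_def by blast
  next
    fix a b assume "a \<in> S <#> C" "b \<in> S <#> C"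
    then obtain s c t d where sc: "s \<in> S" "c \<in> C" "a = s \<otimes> c" "t \<in> S" "d \<in> C" "b = t \<otimes> d"
      by (auto simp: set_mult_def)
    then have "a \<otimes> b = s \<otimes> (c \<otimes> t) \<otimes> d" by (simp add: m_assoc)
    also have "\<dots> = (s \<otimes> t) \<otimes> (c \<otimes> d)" using sc com[of t c, symmetric] by (simp add: m_assoc)
    finally show "a \<otimes> b \<in> S <#> C" using sc unfolding set_mult_def by blast
  qed
  assume tr: "S \<inter> C = {\<one>}"
  have "inj_on (\<lambda>(s, c). s \<otimes> c) (S \<times> C)"
  proof (rule inj_onI, clarify)
    fix s c t d assume m: "s \<in> S" "c \<in> C" "t \<in> S" "d \<in> C" and eq: "s \<otimes> c = t \<otimes> d"
    have "inv t \<otimes> (s \<otimes> c) \<otimes> inv c = inv t \<otimes> (t \<otimes> d) \<otimes> inv c" using eq by simp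
    then have e: "inv t \<otimes> s = d \<otimes> inv c" using m by (simp add: m_assoc inv_mult_cancel_left)
    moreover have "inv t \<otimes> s \<in> S" "d \<otimes> inv c \<in> C" using m by simp_all
    ultimately have "inv t \<otimes> s = \<one>" "d \<otimes> inv c = \<one>" using tr by auto
    then have "t \<otimes> (inv t \<otimes> s) = t" "d \<otimes> inv c \<otimes> c = c" using m by simp_all
    then show "s = t \<and> c = d" using m by (simp add: m_assoc mult_inv_cancel_left)
  qed
  moreover have "(\<lambda>(s, c). s \<otimes> c) ` (S \<times> C) = S <#> C" by (auto simp: set_mult_def)
  ultimately show "card (S <#> C) = card S * card C"
    by (metis card_cartesian_product card_image)
qed

section \<open>Actions of p-groups and Sylow subgroups\<close>

text \<open>Actions in the library are homomorphisms to a group of extensional bijections; this rule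
  asks for the two axioms of an action only.\<close>

lemma (in group) group_actionI:
  assumes cl: "\<And>g x. g \<in> carrier G \<Longrightarrow> x \<in> E \<Longrightarrow> \<phi> g x \<in> E"
    and one: "\<And>x. x \<in> E \<Longrightarrow> \<phi> \<one> x = x"
    and mult: "\<And>g h x. g \<in> carrier G \<Longrightarrow> h \<in> carrier G \<Longrightarrow> x \<in> E \<Longrightarrow> \<phi> (g \<otimes> h) x = \<phi> g (\<phi> h x)"
  shows "group_action G E (\<lambda>g. \<lambda>x\<in>E. \<phi> g x)"
proof -
  have "bij_betw (\<lambda>x\<in>E. \<phi> g x) E E" if g: "g \<in> carrier G" for g
    by (rule bij_betwI[where g = "\<phi> (inv g)"])
      (use g cl in \<open>auto simp: mult[symmetric] one\<close>)
  then have b: "(\<lambda>x\<in>E. \<phi> g x) \<in> Bij E" if "g \<in> carrier G" for g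
    using that by (simp add: Bij_def)
  have m: "(\<lambda>x\<in>E. \<phi> (g \<otimes> h) x) = compose E (\<lambda>x\<in>E. \<phi> g x) (\<lambda>x\<in>E. \<phi> h x)"
    if "g \<in> carrier G" "h \<in> carrier G" for g h
    using that by (auto simp: compose_def mult cl)
  show ?thesis
    unfolding group_action_def
    by (intro group_hom.intro is_group group_BijGroup group_hom_axioms.intro)
      (use b m in \<open>auto simp: hom_def BijGroup_def\<close>)
qed

text \<open>A nontrivial orbit of a \<open>p\<close>-group has a length divisible by \<open>p\<close>.\<close>

lemma (in group_action) prime_dvd_card_nonfixed:
  assumes p: "Factorial_Ring.prime p" and G: "order G = p ^ k" and E: "finite E"
  shows "p dvd card {x \<in> E. \<exists>g\<in>carrier G. \<phi> g x \<noteq> x}"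
proof -
  define F where "F = {x \<in> E. \<exists>g\<in>carrier G. \<phi> g x \<noteq> x}"
  have orb_sub: "orbit G \<phi> x \<subseteq> E" if "x \<in> E" for x
    using element_image[OF _ that] by (auto simp: orbit_def)
  have orb_F: "orbit G \<phi> x \<subseteq> F" if x: "x \<in> F" for x
  proof
    fix y assume y: "y \<in> orbit G \<phi> x"
    have xE: "x \<in> E" using x by (simp add: F_def)
    then have yE: "y \<in> E" using orb_sub y by blast
    have "x \<in> orbit G \<phi> y" using orbit_sym[OF xE yE y] .
    show "y \<in> F"
    proof (rule ccontr)
      assume "y \<notin> F"
      then have "\<forall>g\<in>carrier G. \<phi> g y = y" using yE by (auto simp: F_def)
      then have "x = y" using \<open>x \<in> orbit G \<phi> y\<close> by (auto simp: orbit_def)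
      then show False using x \<open>y \<notin> F\<close> by simp
    qed
  qed
  have U: "\<Union> (orbit G \<phi> ` F) = F"
    using orb_F orbit_refl by (force simp: F_def)
  have "p dvd card (\<Union> (orbit G \<phi> ` F))"
  proof (rule dvd_partition)
    show "finite (\<Union> (orbit G \<phi> ` F))" unfolding U using E by (simp add: F_def)
    show "\<forall>c\<in>orbit G \<phi> ` F. p dvd card c"
    proof
      fix c assume "c \<in> orbit G \<phi> ` F"
      then obtain x where x: "x \<in> F" "c = orbit G \<phi> x" by blast
      have xE: "x \<in> E" using x by (simp add: F_def)
      obtain g where g: "g \<in> carrier G" "\<phi> g x \<noteq> x" using x by (auto simp: F_def)
      have "card c dvd p ^ k" using orbit_stabilizer_theorem[OF xE] x(2) G by (metis dvd_triv_left)
      moreover have "card c \<noteq> 1"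
      proof
        assume "card c = 1"
        moreover have "x \<in> c" "\<phi> g x \<in> c" using x(2) g(1) orbit_refl[OF xE] by (auto simp: orbit_def)
        ultimately show False using g(2) by (metis card_1_singletonE singletonD)
      qed
      ultimately show "p dvd card c" using p by (metis divides_primepow_nat dvd_power gr0I power_0)
    qed
    show "\<forall>c1\<in>orbit G \<phi> ` F. \<forall>c2\<in>orbit G \<phi> ` F. c1 \<noteq> c2 \<longrightarrow> c1 \<inter> c2 = {}"
      using disjoint_union by (auto simp: orbits_def F_def)
  qed
  then show ?thesis unfolding U by (simp add: F_def)
qed

text \<open>The conjugacy classes with more than one element have a total size divisible by \<open>p\<close>. If
  \<open>\<one>\<close> were the only central element, this size would be \<open>order G - 1\<close>, which is prime to \<open>p\<close>.\<close>

lemma (in group) p_group_central_element: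
  assumes p: "Factorial_Ring.prime p" and G: "order G = p ^ k" "k \<noteq> 0"
  shows "\<exists>z\<in>carrier G. z \<noteq> \<one> \<and> (\<forall>g\<in>carrier G. g \<otimes> z = z \<otimes> g)"
proof (rule ccontr)
  assume nz: "\<not> ?thesis"
  interpret act: group_action G "carrier G" "\<lambda>g. \<lambda>h\<in>carrier G. g \<otimes> h \<otimes> inv g"
    by (rule action_by_conjugation)
  have fin: "finite (carrier G)" using p G order_gt_0_iff_finite by (simp add: prime_gt_0_nat)
  have "{x \<in> carrier G. \<exists>g\<in>carrier G. (\<lambda>h\<in>carrier G. g \<otimes> h \<otimes> inv g) x \<noteq> x} = carrier G - {\<one>}"
  proof (intro Set.equalityI Set.subsetI)
    fix x assume "x \<in> carrier G - {\<one>}"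
    then obtain g where g: "g \<in> carrier G" "g \<otimes> x \<noteq> x \<otimes> g" "x \<in> carrier G" using nz by blast
    then have "g \<otimes> x \<otimes> inv g \<noteq> x" by (metis inv_solve_right m_closed)
    then show "x \<in> {x \<in> carrier G. \<exists>g\<in>carrier G. (\<lambda>h\<in>carrier G. g \<otimes> h \<otimes> inv g) x \<noteq> x}"
      using g by auto
  qed auto
  then have "p dvd card (carrier G - {\<one>})"
    using act.prime_dvd_card_nonfixed[OF p G(1) fin] by simp
  then have "p dvd order G - 1" using fin by (simp add: order_def)
  moreover have "p dvd order G" using G by simp
  moreover have "order G \<ge> 1" using fin order_gt_0_iff_finite by linarith
  ultimately have "p dvd 1" by (metis dvd_diffD1)
  then show False using p by simp
qed

text \<open>Sylow's second theorem, needed for the Frattini argument.\<close>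

lemma (in group) sylow_conjugate:
  assumes fin: "finite (carrier G)" and p: "Factorial_Ring.prime p"
    and G: "order G = p ^ a * m" "\<not> p dvd m"
    and P: "subgroup P G" "card P = p ^ a" and Q: "subgroup Q G" "card Q = p ^ a"
  shows "\<exists>g\<in>carrier G. Q = (\<lambda>x. g \<otimes> x \<otimes> inv g) ` P"
proof -
  interpret P: subgroup P G by (rule P)
  interpret Q: subgroup Q G by (rule Q)
  interpret GQ: group "G\<lparr>carrier := Q\<rparr>" by (rule subgroup_imp_group[OF Q(1)])
  have sub: "C \<subseteq> carrier G" if "C \<in> rcosets P" for C using P.rcosets_carrier[OF is_group that] .
  have cl: "C #> g \<in> rcosets P" if C: "C \<in> rcosets P" and g: "g \<in> carrier G" for C g
  proof -
    obtain c where c: "c \<in> carrier G" "C = P #> c" using C by (auto simp: RCOSETS_def)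
    then show ?thesis using coset_mult_assoc[of P c g] P.subset rcosetsI[of P "c \<otimes> g"] g by auto
  qed
  \<comment> \<open>\<open>Q\<close> acts on the cosets of \<open>P\<close>, whose number is prime to \<open>p\<close>, so it fixes one of them.\<close>
  interpret act: group_action "G\<lparr>carrier := Q\<rparr>" "rcosets P" "\<lambda>q. \<lambda>C\<in>rcosets P. C #> inv q"
    by (rule GQ.group_actionI)
      (use cl sub in \<open>auto simp: coset_mult_assoc inv_mult_group\<close>)
  have fr: "finite (rcosets P)"
    using fin rcosets_subset_PowG[OF P(1)] by (meson finite_Pow_iff finite_subset)
  have "card (rcosets P) * p ^ a = p ^ a * m" using lagrange[OF P(1)] P(2) G(1) by simp
  then have "card (rcosets P) = m" using p by (simp add: prime_gt_0_nat)
  let ?N = "{C \<in> rcosets P. \<exists>q\<in>carrier (G\<lparr>carrier := Q\<rparr>). (\<lambda>C\<in>rcosets P. C #> inv q) C \<noteq> C}"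
  have "p dvd card ?N"
    by (rule act.prime_dvd_card_nonfixed[OF p _ fr]) (simp add: order_def Q(2))
  then have "?N \<noteq> rcosets P" using G(2) \<open>card (rcosets P) = m\<close> by metis
  then obtain C where C: "C \<in> rcosets P" "\<forall>q\<in>Q. C #> inv q = C" by force
  obtain c where c: "c \<in> carrier G" "C = P #> c" using C by (auto simp: RCOSETS_def)
  have "Q \<subseteq> (\<lambda>x. inv c \<otimes> x \<otimes> inv (inv c)) ` P"
  proof
    fix q assume q: "q \<in> Q"
    have "c \<in> P #> c" using rcos_self[OF c(1) P(1)] .
    moreover have "(P #> c) #> inv (inv q) = P #> c" using C(2) c(2) Q.m_inv_closed[OF q] by simp
    ultimately have "c \<otimes> q \<in> P #> c" using q by (force simp: r_coset_def)
    then obtain x where x: "x \<in> P" "c \<otimes> q = x \<otimes> c" by (auto simp: r_coset_def)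
    then have "q = inv c \<otimes> (x \<otimes> c)" using c q by (metis Q.mem_carrier inv_mult_cancel_left)
    then show "q \<in> (\<lambda>x. inv c \<otimes> x \<otimes> inv (inv c)) ` P" using x c by (auto simp: m_assoc)
  qed
  moreover have "card ((\<lambda>x. inv c \<otimes> x \<otimes> inv (inv c)) ` P) = card Q"
    using card_conjugate[of "inv c" P] c P Q P.subset by simp
  moreover have "finite ((\<lambda>x. inv c \<otimes> x \<otimes> inv (inv c)) ` P)"
    using fin P.subset by (meson finite_imageI finite_subset)
  ultimately have "Q = (\<lambda>x. inv c \<otimes> x \<otimes> inv (inv c)) ` P" by (metis card_subset_eq)
  then show ?thesis using c by blast
qed

text \<open>The conjugates of \<open>x \<noteq> \<one>\<close> under the normalizer lie among the \<open>p - 1\<close> nontrivial elements of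
  \<open>P\<close>. Their number divides the group order and is less than its least prime factor, so it is \<open>1\<close>.\<close>

lemma (in group) least_prime_subgroup_central_in_normalizer:
  assumes fin: "finite (carrier G)" and p: "Factorial_Ring.prime p"
    and least: "\<And>q. Factorial_Ring.prime q \<Longrightarrow> q dvd order G \<Longrightarrow> p \<le> q"
    and P: "subgroup P G" "card P = p" and x: "x \<in> P" and y: "y \<in> normalizer G P"
  shows "y \<otimes> x = x \<otimes> y"
proof (cases "x = \<one>")
  case True
  then show ?thesis using y subgroup.mem_carrier[OF normalizer_superset(1)[OF fin P(1)]] by simp
next
  case False
  define T where "T = normalizer G P"
  interpret P: subgroup P G by (rule P)
  have T: "subgroup T G" "P \<subseteq> T" unfolding T_def by (rule normalizer_superset[OF fin P(1)])+
  interpret T: subgroup T G by (rule T)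
  interpret GT: group "G\<lparr>carrier := T\<rparr>" by (rule subgroup_imp_group[OF T(1)])
  let ?\<phi> = "\<lambda>g. \<lambda>h\<in>T. g \<otimes> h \<otimes> inv\<^bsub>G\<lparr>carrier := T\<rparr>\<^esub> g"
  interpret act: group_action "G\<lparr>carrier := T\<rparr>" T ?\<phi>
    using GT.action_by_conjugation by simp
  have xT: "x \<in> T" using x T by blast
  define Orb where "Orb = orbit (G\<lparr>carrier := T\<rparr>) ?\<phi> x"
  have orb: "Orb = {g \<otimes> x \<otimes> inv g |g. g \<in> T}"
  proof -
    have "?\<phi> g x = g \<otimes> x \<otimes> inv g" if "g \<in> T" for g
      using xT m_inv_consistent[OF T(1) that] by simp
    then have "(\<lambda>g. ?\<phi> g x) ` T = (\<lambda>g. g \<otimes> x \<otimes> inv g) ` T" by (rule image_cong[OF refl])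
    moreover have "Orb = (\<lambda>g. ?\<phi> g x) ` carrier (G\<lparr>carrier := T\<rparr>)"
      unfolding Orb_def orbit_def by (rule Setcompr_eq_image)
    moreover have "carrier (G\<lparr>carrier := T\<rparr>) = T" by simp
    ultimately show ?thesis unfolding Setcompr_eq_image by metis
  qed
  have OP: "Orb \<subseteq> P - {\<one>}"
  proof
    fix z assume "z \<in> Orb"
    then obtain g where g: "g \<in> T" "z = g \<otimes> x \<otimes> inv g" by (auto simp: orb)
    then have "z \<in> P" using x mem_normalizer_iff[OF fin P.subset] by (simp add: T_def)
    moreover have "z \<noteq> \<one>"
      using conj_eq_one_iff[of g x] g x False by simp
    ultimately show "z \<in> P - {\<one>}" by simp
  qed
  have finP: "finite P" using fin P.subset finite_subset by blast
  have cO: "card Orb < p"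
    using card_mono[OF _ OP] finP P(2) card_Diff_singleton[OF P.one_closed] p prime_gt_0_nat[of p] by fastforce
  have "card Orb dvd card T"
    using act.orbit_stabilizer_theorem[OF xT] by (auto simp: Orb_def order_def intro: dvdI[OF sym])
  then have dvd: "card Orb dvd order G"
    using card_subgroup_dvd[OF T(1) subgroup_self T.subset] by (auto simp: order_def intro: dvd_trans)
  have "card Orb = 1"
  proof (rule ccontr)
    assume "card Orb \<noteq> 1"
    then obtain q where q: "Factorial_Ring.prime q" "q dvd card Orb" using prime_factor_nat by blast
    have "x \<in> Orb" using xT by (auto simp: orb intro!: exI[of _ \<one>])
    then have "card Orb \<noteq> 0" using finP OP by (metis card_0_eq empty_iff finite_Diff finite_subset)
    then have "q \<le> card Orb" using q(2) by (simp add: dvd_imp_le)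
    then show False using least[OF q(1)] q(2) dvd cO by (meson dvd_trans leD le_trans)
  qed
  then obtain z where z: "Orb = {z}" by (auto simp: card_1_singleton_iff)
  have yT: "y \<in> T" using y by (simp add: T_def)
  have "\<one> \<otimes> x \<otimes> inv \<one> \<in> Orb" "y \<otimes> x \<otimes> inv y \<in> Orb" using yT T.one_closed unfolding orb by blast+
  then have "y \<otimes> x \<otimes> inv y = x" using z x by simp
  then show ?thesis using conj_fixed_iff yT x by simp
qed

section \<open>Transfer into abelian TI subgroups\<close>

text \<open>The transfer into an abelian subgroup \<open>A\<close> that meets each of its other conjugates trivially
  (a TI subgroup) and is its own normalizer. Under this hypothesis \<open>A\<close> acts freely on the cosets
  other than \<open>A\<close> itself, so the transfer can be computed from a choice of representatives that is
  invariant under \<open>A\<close> outside the coset \<open>A\<close>, and it is then the identity on \<open>A\<close>.\<close>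

lemma (in group) retraction_onto_abelian_TI_subgroup:
  assumes fin: "finite (carrier G)" and A: "subgroup A G"
    and comm: "\<And>a b. a \<in> A \<Longrightarrow> b \<in> A \<Longrightarrow> a \<otimes> b = b \<otimes> a"
    and ti: "\<And>g a. g \<in> carrier G - A \<Longrightarrow> a \<in> A \<Longrightarrow> g \<otimes> a \<otimes> inv g \<in> A \<Longrightarrow> a = \<one>"
  shows "\<exists>h \<in> hom G (G\<lparr>carrier := A\<rparr>). \<forall>a\<in>A. h a = a"
proof -
  interpret A: subgroup A G by (rule A)
  interpret B: comm_group "G\<lparr>carrier := A\<rparr>"
    using A.subgroup_is_group[OF is_group] comm by (intro group.group_comm_groupI) auto
  note cl[simp] = A.m_closed A.m_inv_closed
  have AG[simp]: "a \<in> A \<Longrightarrow> a \<in> carrier G" for a by simp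
  \<comment> \<open>A representative \<open>s\<close> is fixed in every double coset \<open>D g = A g A\<close>. Off \<open>A\<close> the condition
    \<open>ti\<close> makes the factorization \<open>g = a \<otimes> s g \<otimes> b\<close> unique, and \<open>f g\<close> is its left factor \<open>a\<close>: so
    \<open>f (a \<otimes> g) = a \<otimes> f g\<close> holds on \<open>G\<close>, and off \<open>A\<close> multiplication by \<open>A\<close> on the right
    does not change \<open>f\<close>.\<close>
  define D where "D g = {a \<otimes> g \<otimes> b | a b. a \<in> A \<and> b \<in> A}" for g
  define s where "s g = (SOME x. x \<in> D g)" for g
  define f where "f g = (if g \<in> A then g else SOME a. a \<in> A \<and> (\<exists>b\<in>A. g = a \<otimes> s g \<otimes> b))" for g
  have notA: "a \<otimes> g \<otimes> b \<notin> A" if g: "g \<in> carrier G - A" and ab: "a \<in> A" "b \<in> A" for a b g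
  proof
    assume "a \<otimes> g \<otimes> b \<in> A"
    then have "inv a \<otimes> (a \<otimes> g \<otimes> b) \<otimes> inv b \<in> A" using ab by simp
    moreover have "inv a \<otimes> (a \<otimes> g \<otimes> b) \<otimes> inv b = g" using g ab by (simp add: m_assoc mult_inv_cancel_left inv_mult_cancel_left)
    ultimately show False using g by simp
  qed
  have D_sub: "D (a \<otimes> g \<otimes> b) \<subseteq> D g" if g: "g \<in> carrier G" and ab: "a \<in> A" "b \<in> A" for a b g
  proof
    fix y assume "y \<in> D (a \<otimes> g \<otimes> b)"
    then obtain c d where cd: "c \<in> A" "d \<in> A" "y = c \<otimes> (a \<otimes> g \<otimes> b) \<otimes> d" unfolding D_def by blast
    have "y = (c \<otimes> a) \<otimes> g \<otimes> (b \<otimes> d)" using cd g ab by (simp add: m_assoc)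
    then show "y \<in> D g" unfolding D_def using cd ab A.m_closed by blast
  qed
  have D_eq: "D (a \<otimes> g \<otimes> b) = D g" if g: "g \<in> carrier G" and ab: "a \<in> A" "b \<in> A" for a b g
  proof
    have "g = inv a \<otimes> (a \<otimes> g \<otimes> b) \<otimes> inv b" using g ab by (simp add: m_assoc mult_inv_cancel_left inv_mult_cancel_left)
    then show "D g \<subseteq> D (a \<otimes> g \<otimes> b)"
      using D_sub[of "a \<otimes> g \<otimes> b" "inv a" "inv b"] g ab by simp
  qed (rule D_sub[OF that])
  have s_D: "s g \<in> D g" if "g \<in> carrier G" for g
  proof -
    have "\<one> \<otimes> g \<otimes> \<one> \<in> D g" unfolding D_def using A.one_closed by blast
    then show ?thesis unfolding s_def by (rule someI)
  qed
  have s_notA: "s g \<in> carrier G - A" if g: "g \<in> carrier G - A" for g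
  proof -
    obtain a b where ab: "a \<in> A" "b \<in> A" "s g = a \<otimes> g \<otimes> b" using s_D[of g] g unfolding D_def by blast
    then show ?thesis using notA[OF g ab(1,2)] g by simp
  qed
  have decomp: "\<exists>a\<in>A. \<exists>b\<in>A. g = a \<otimes> s g \<otimes> b" if g: "g \<in> carrier G" for g
  proof -
    obtain a b where ab: "a \<in> A" "b \<in> A" "s g = a \<otimes> g \<otimes> b" using s_D[of g] g unfolding D_def by blast
    have "g = inv a \<otimes> s g \<otimes> inv b" using g ab by (simp add: m_assoc mult_inv_cancel_left inv_mult_cancel_left)
    then show ?thesis using ab A.m_inv_closed by blast
  qed
  have uniq: "a = a'" if s: "x \<in> carrier G - A" and m: "a \<in> A" "a' \<in> A" "b \<in> A" "b' \<in> A"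
    and eq: "a \<otimes> x \<otimes> b = a' \<otimes> x \<otimes> b'" for x a a' b b'
  proof -
    have xc: "x \<in> carrier G" using s by simp
    have "inv a' \<otimes> (a \<otimes> x \<otimes> b) \<otimes> inv b \<otimes> inv x= inv a' \<otimes> (a' \<otimes> x \<otimes> b') \<otimes> inv b \<otimes> inv x" using eq by simp
    moreover have "inv a' \<otimes> (a \<otimes> x \<otimes> b) \<otimes> inv b \<otimes> inv x = inv a' \<otimes> a"
      using m xc by (simp add: m_assoc mult_inv_cancel_left inv_mult_cancel_left)
    moreover have "inv a' \<otimes> (a' \<otimes> x \<otimes> b') \<otimes> inv b \<otimes> inv x = x \<otimes> (b' \<otimes> inv b) \<otimes> inv x"
      using m xc by (simp add: m_assoc mult_inv_cancel_left inv_mult_cancel_left)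
    ultimately have e: "inv a' \<otimes> a = x \<otimes> (b' \<otimes> inv b) \<otimes> inv x" by metis
    have "b' \<otimes> inv b = \<one>"
    proof (rule ti[OF s])
      show "b' \<otimes> inv b \<in> A" using m by simp
      show "x \<otimes> (b' \<otimes> inv b) \<otimes> inv x \<in> A" unfolding e[symmetric] using m by simp
    qed
    then have "inv a' \<otimes> a = \<one>" using e xc by simp
    then have "a' \<otimes> (inv a' \<otimes> a) = a'" using m by simp
    then show ?thesis using m by (simp add: mult_inv_cancel_left)
  qed
  have f_spec: "f g \<in> A \<and> (\<exists>b\<in>A. g = f g \<otimes> s g \<otimes> b)" if g: "g \<in> carrier G - A" for g
  proof -
    have "\<exists>a. a \<in> A \<and> (\<exists>b\<in>A. g = a \<otimes> s g \<otimes> b)" using decomp g by blast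
    from someI_ex[OF this] show ?thesis using g by (simp add: f_def)
  qed
  have f_A: "f g \<in> A" if "g \<in> carrier G" for g
    using f_spec[of g] that by (cases "g \<in> A") (auto simp: f_def)
  have f_lr: "f (a \<otimes> g \<otimes> c) = a \<otimes> f g" if g: "g \<in> carrier G - A" and ac: "a \<in> A" "c \<in> A" for a g c
  proof -
    let ?g = "a \<otimes> g \<otimes> c"
    have g': "?g \<in> carrier G - A" using notA g ac by simp
    have ss: "s ?g = s g" using D_eq g ac by (simp add: s_def)
    obtain b where b: "b \<in> A" "g = f g \<otimes> s g \<otimes> b" using f_spec[OF g] by blast
    obtain b' where b': "b' \<in> A" "?g = f ?g \<otimes> s g \<otimes> b'" using f_spec[OF g'] ss by auto
    have mem: "f g \<in> A" "f ?g \<in> A" using f_A g g' by auto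
    have sg: "s g \<in> carrier G - A" using s_notA[OF g] .
    have "?g = a \<otimes> (f g \<otimes> s g \<otimes> b) \<otimes> c" using b by simp
    also have "\<dots> = (a \<otimes> f g) \<otimes> s g \<otimes> (b \<otimes> c)" using sg mem ac b(1) by (simp add: m_assoc)
    finally have "f ?g \<otimes> s g \<otimes> b' = (a \<otimes> f g) \<otimes> s g \<otimes> (b \<otimes> c)" using b' by simp
    then show ?thesis by (rule uniq[OF sg, rotated -1]) (use mem ac b b' in auto)
  qed
  have f_l: "f (a \<otimes> g) = a \<otimes> f g" if g: "g \<in> carrier G" and a: "a \<in> A" for a g
  proof (cases "g \<in> A")
    case True then show ?thesis using a by (simp add: f_def)
  next
    case False
    then show ?thesis using f_lr[of g a \<one>] g a by simp
  qed
  \<comment> \<open>The factor \<open>\<phi> x g\<close> only depends on the coset \<open>A #> g\<close>, since \<open>A\<close> is abelian; \<open>V\<close> is the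
    transfer, the product of these factors over all cosets.\<close>
  define \<phi> where "\<phi> x g = f (g \<otimes> x) \<otimes> inv (f g)" for x g
  have \<phi>_A: "\<phi> x g \<in> A" if "x \<in> carrier G" "g \<in> carrier G" for x g
    using f_A that by (simp add: \<phi>_def)
  have \<phi>_l: "\<phi> x (a \<otimes> g) = \<phi> x g" if "x \<in> carrier G" "g \<in> carrier G" "a \<in> A" for x a g
  proof -
    have m: "f (g \<otimes> x) \<in> A" "f g \<in> A" using f_A that by auto
    have "\<phi> x (a \<otimes> g) = a \<otimes> f (g \<otimes> x) \<otimes> inv (a \<otimes> f g)" using f_l that by (simp add: \<phi>_def m_assoc)
    also have "\<dots> = f (g \<otimes> x) \<otimes> a \<otimes> inv (f g \<otimes> a)" using comm m that by simp
    also have "\<dots> = \<phi> x g" using m that by (simp add: \<phi>_def inv_mult_group m_assoc mult_inv_cancel_left inv_mult_cancel_left)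
    finally show ?thesis .
  qed
  define r where "r C = (SOME g. g \<in> C)" for C :: "'a set"
  have r_in: "r C \<in> C" if "C \<in> rcosets A" for C
    using A.rcosets_non_empty[OF that] unfolding r_def by (simp add: some_in_eq)
  have r_car: "r C \<in> carrier G" if "C \<in> rcosets A" for C
    using A.rcosets_carrier[OF is_group that] r_in[OF that] by (rule subsetD)
  have \<phi>_coset: "\<phi> x g = \<phi> x h" if gh: "C \<in> rcosets A" "g \<in> C" "h \<in> C" "x \<in> carrier G" for C g h x
  proof -
    obtain c where c: "c \<in> carrier G" "C = A #> c" using gh(1) by (auto simp: RCOSETS_def)
    obtain a b where "a \<in> A" "g = a \<otimes> c" "b \<in> A" "h = b \<otimes> c" using gh c by (auto simp: r_coset_def)
    then show ?thesis using \<phi>_l[OF gh(4) c(1)] by simp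
  qed
  define V where "V x = finprod (G\<lparr>carrier := A\<rparr>) (\<lambda>C. \<phi> x (r C)) (rcosets A)" for x
  have V_A: "V x \<in> A" if "x \<in> carrier G" for x
    using B.finprod_closed[of "\<lambda>C. \<phi> x (r C)" "rcosets A"] \<phi>_A r_car that by (auto simp: V_def)
  have V_hom: "V (x \<otimes> y) = V x \<otimes> V y" if xy: "x \<in> carrier G" "y \<in> carrier G" for x y
  proof -
    have sh: "C #> x \<in> rcosets A" "r C \<otimes> x \<in> C #> x" if C: "C \<in> rcosets A" for C
    proof -
      obtain c where c: "c \<in> carrier G" "C = A #> c" using C by (auto simp: RCOSETS_def)
      then show "C #> x \<in> rcosets A" using xy coset_mult_assoc[of A c x] A.subset rcosetsI[of A "c \<otimes> x"] by auto
      show "r C \<otimes> x \<in> C #> x" using r_in[OF C] unfolding r_coset_def by blast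
    qed
    have Csub: "C \<in> rcosets A \<Longrightarrow> C \<subseteq> carrier G" for C using A.rcosets_carrier[OF is_group] .
    \<comment> \<open>Right multiplication by \<open>x\<close> permutes the cosets, so the product defining \<open>V y\<close> may be
      taken at the shifted representatives.\<close>
    have inj: "inj_on (\<lambda>C. C #> x) (rcosets A)"
      by (rule inj_on_inverseI[of _ "\<lambda>C. C #> inv x"]) (use xy Csub coset_mult_assoc in auto)
    have fr: "finite (rcosets A)"
      using fin rcosets_subset_PowG[OF A] by (meson finite_Pow_iff finite_subset)
    have img: "(\<lambda>C. C #> x) ` (rcosets A) = rcosets A"
      by (rule endo_inj_surj[OF fr _ inj]) (use sh in auto)
    have "V y = finprod (G\<lparr>carrier := A\<rparr>) (\<lambda>C. \<phi> y (r C)) ((\<lambda>C. C #> x) ` (rcosets A))"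
      by (simp add: V_def img)
    also have "\<dots> = finprod (G\<lparr>carrier := A\<rparr>) (\<lambda>C. \<phi> y (r (C #> x))) (rcosets A)"
      by (rule B.finprod_reindex[OF _ inj]) (use img \<phi>_A r_car xy in auto)
    also have "\<dots> = finprod (G\<lparr>carrier := A\<rparr>) (\<lambda>C. \<phi> y (r C \<otimes> x)) (rcosets A)"
      by (rule B.finprod_cong') (use \<phi>_coset[OF sh(1) r_in[OF sh(1)] sh(2)] xy \<phi>_A r_car in auto)
    finally have Vy: "V y = finprod (G\<lparr>carrier := A\<rparr>) (\<lambda>C. \<phi> y (r C \<otimes> x)) (rcosets A)" .
    have \<phi>m: "\<phi> (x \<otimes> y) g = \<phi> x g \<otimes> \<phi> y (g \<otimes> x)" if g: "g \<in> carrier G" for g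
    proof -
      have m: "f (g \<otimes> x) \<in> A" "f g \<in> A" "f (g \<otimes> x \<otimes> y) \<in> A" using f_A xy g by auto
      have "\<phi> x g \<otimes> \<phi> y (g \<otimes> x) = \<phi> y (g \<otimes> x) \<otimes> \<phi> x g" using comm \<phi>_A xy g by simp
      also have "\<dots> = \<phi> (x \<otimes> y) g" using m xy g by (simp add: \<phi>_def m_assoc mult_inv_cancel_left inv_mult_cancel_left)
      finally show ?thesis by simp
    qed
    have "V (x \<otimes> y) = finprod (G\<lparr>carrier := A\<rparr>) (\<lambda>C. \<phi> x (r C) \<otimes> \<phi> y (r C \<otimes> x)) (rcosets A)"
      unfolding V_def by (rule B.finprod_cong') (use \<phi>m \<phi>_A r_car xy in auto)
    also have "\<dots> = V x \<otimes> V y"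
      unfolding Vy using B.finprod_multf[of "\<lambda>C. \<phi> x (r C)" "rcosets A" "\<lambda>C. \<phi> y (r C \<otimes> x)"] \<phi>_A r_car xy
      by (auto simp: V_def)
    finally show ?thesis .
  qed
  have V_id: "V x = x" if x: "x \<in> A" for x
  proof -
    have AA: "A \<in> rcosets A" using A.subgroup_in_rcosets[OF is_group] .
    have fr: "finite (rcosets A)"
      using fin rcosets_subset_PowG[OF A] by (meson finite_Pow_iff finite_subset)
    \<comment> \<open>Off \<open>A\<close> the function \<open>f\<close> does not see \<open>x\<close>, so only the coset \<open>A\<close> contributes.\<close>
    have "\<phi> x (r C) = (if A = C then x else \<one>)" if C: "C \<in> rcosets A" for C
    proof (cases "A = C")
      case True
      have "\<phi> x (r C) = \<phi> x \<one>" using \<phi>_coset[OF C r_in[OF C], of \<one> x] A.one_closed True x by auto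
      also have "\<phi> x \<one> = x" using x by (simp add: \<phi>_def f_def)
      finally show ?thesis using True by simp
    next
      case False
      have "r C \<notin> A"
      proof
        assume "r C \<in> A"
        then have "r C \<in> A \<inter> C" using r_in[OF C] by simp
        then show False using rcos_disjoint[OF A] AA C False by (auto simp: pairwise_def disjnt_def)
      qed
      then have "f (r C \<otimes> x) = f (r C)" using f_lr[of "r C" \<one> x] x r_car[OF C] f_A by simp
      then show ?thesis using False f_A r_car[OF C] by (simp add: \<phi>_def)
    qed
    then have "V x = finprod (G\<lparr>carrier := A\<rparr>) (\<lambda>C. if A = C then x else \<one>\<^bsub>G\<lparr>carrier := A\<rparr>\<^esub>) (rcosets A)"
      unfolding V_def by (intro B.finprod_cong') (use x in auto)
    also have "\<dots> = x" by (rule B.finprod_singleton[OF AA fr]) (use x in auto)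
    finally show ?thesis .
  qed
  have "V \<in> hom G (G\<lparr>carrier := A\<rparr>)" by (auto simp: hom_def V_A V_hom)
  then show ?thesis using V_id by blast
qed

text \<open>The form in which the transfer is used: a simple group has no nontrivial proper subgroup of this
  kind, since the kernel of the retraction would be a normal subgroup.\<close>

lemma (in group) abelian_TI_subgroup_imp_normal_subgroup:
  assumes fin: "finite (carrier G)" and A: "subgroup A G" and ne: "A \<noteq> {\<one>}" "A \<noteq> carrier G"
    and comm: "\<And>a b. a \<in> A \<Longrightarrow> b \<in> A \<Longrightarrow> a \<otimes> b = b \<otimes> a"
    and ti: "\<And>g a. g \<in> carrier G - A \<Longrightarrow> a \<in> A \<Longrightarrow> g \<otimes> a \<otimes> inv g \<in> A \<Longrightarrow> a = \<one>"
  shows "\<exists>K. K \<lhd> G \<and> K \<noteq> {\<one>} \<and> K \<noteq> carrier G"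
proof -
  have "\<exists>h \<in> hom G (G\<lparr>carrier := A\<rparr>). \<forall>a\<in>A. h a = a"
    by (rule retraction_onto_abelian_TI_subgroup[OF fin A]) (fact comm, fact ti)
  then obtain h where h: "h \<in> hom G (G\<lparr>carrier := A\<rparr>)" "\<forall>a\<in>A. h a = a" by blast
  interpret h: group_hom G "G\<lparr>carrier := A\<rparr>" h
    by (intro group_hom.intro is_group subgroup_imp_group[OF A] group_hom_axioms.intro h(1))
  let ?K = "kernel G (G\<lparr>carrier := A\<rparr>) h"
  obtain a where a: "a \<in> A" "a \<noteq> \<one>" using ne(1) subgroup.one_closed[OF A] by blast
  then have "a \<in> carrier G" "a \<notin> ?K" using h(2) subgroup.subset[OF A] by (auto simp: kernel_def)
  moreover obtain g where g: "g \<in> carrier G" "g \<notin> A" using ne(2) subgroup.subset[OF A] by blast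
  \<comment> \<open>A retraction \<open>h\<close> sends \<open>g\<close> and \<open>h g\<close> to the same element, which yields a nontrivial kernel.\<close>
  define k where "k = g \<otimes> inv (h g)"
  have hg: "h g \<in> A" using g h.hom_closed by simp
  then have hgc: "h g \<in> carrier G" "inv (h g) \<in> A" using A subgroup.mem_carrier subgroup.m_inv_closed by fast+
  then have "h k = \<one>" using g h hg h.hom_mult[of g "inv (h g)"] by (simp add: k_def)
  moreover have "k \<noteq> \<one>" 
  proof
    assume "k = \<one>"
    then have "g \<otimes> inv (h g) \<otimes> h g = h g" using hgc by (simp add: k_def)
    then have "g = h g" using g hgc by (simp add: m_assoc)
    then show False using g hg by simp
  qed
  moreover have "k \<in> carrier G" using g hgc by (simp add: k_def)
  ultimately show ?thesis using h.normal_kernel by (auto simp: kernel_def)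
qed

section \<open>Minimal normal subgroups and chief factors\<close>

text \<open>A minimal normal subgroup \<open>N\<close> with trivial centre splits off a simple direct factor: \<open>S\<close> is a
  minimal normal subgroup of \<open>N\<close> and \<open>C\<close> is its centralizer in \<open>N\<close>. A conjugate of \<open>S\<close> under \<open>G\<close>
  is again minimal normal in \<open>N\<close>, so it is \<open>S\<close> or commutes with \<open>S\<close>; thus all conjugates lie
  in \<open>S <#> C\<close>, and they generate \<open>N\<close>. Normal subgroups of \<open>S\<close> are normalized by \<open>C\<close>, which
  makes \<open>S\<close> simple.\<close>

lemma (in group) minimal_normal_direct_decomposition:
  assumes fin: "finite (carrier G)" and N: "chief_factor G N {\<one>}"
    and Z: "N \<inter> centralizer G N = {\<one>}"
  obtains S C where "S \<lhd> G\<lparr>carrier := N\<rparr>" "C \<lhd> G\<lparr>carrier := N\<rparr>" "S \<noteq> {\<one>}" "S \<inter> C = {\<one>}"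
    "S <#> C = N" "\<And>s c. s \<in> S \<Longrightarrow> c \<in> C \<Longrightarrow> s \<otimes> c = c \<otimes> s"
    "\<And>L. L \<lhd> G\<lparr>carrier := S\<rparr> \<Longrightarrow> L = {\<one>} \<or> L = S"
proof -
  have NG: "N \<lhd> G" and N1: "{\<one>} \<subset> N" and min: "\<And>L. L \<lhd> G \<Longrightarrow> {\<one>} \<subset> L \<Longrightarrow> L \<subset> N \<Longrightarrow> False"
    using N by (auto simp: chief_factor_def)
  interpret N: normal N G by (rule NG)
  have Ns: "subgroup N G" by (rule N.subgroup_axioms)
  interpret GN: group "G\<lparr>carrier := N\<rparr>" by (rule subgroup_imp_group[OF Ns])
  note nrm = normal_in_iff[OF Ns]
  define F where "F = {L. L \<lhd> G\<lparr>carrier := N\<rparr> \<and> L \<noteq> {\<one>}}"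
  have "F \<subseteq> Pow (carrier G)" using N.subset by (auto simp: F_def nrm)
  then have finF: "finite F" using fin by (meson finite_Pow_iff finite_subset)
  have "N \<in> F" using N1 Ns by (auto simp: F_def nrm)
  then obtain S where S: "S \<in> F" "\<forall>L\<in>F. L \<subseteq> S \<longrightarrow> S = L"
    using finite_has_minimal2[OF finF] by metis
  have SN: "S \<lhd> G\<lparr>carrier := N\<rparr>" "S \<noteq> {\<one>}" using S by (auto simp: F_def)
  have Ss: "subgroup S G" "S \<subseteq> N" and Sn: "\<And>x s. x \<in> N \<Longrightarrow> s \<in> S \<Longrightarrow> x \<otimes> s \<otimes> inv x \<in> S"
    using SN(1) by (auto simp: nrm)
  interpret S: subgroup S G by (rule Ss)
  define C where "C = N \<inter> centralizer G S"
  have CN: "C \<lhd> G\<lparr>carrier := N\<rparr>" unfolding C_def by (rule normal_centralizer_in[OF Ns SN(1)])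
  have Cs: "subgroup C G" "C \<subseteq> N" using CN by (auto simp: nrm)
  have com: "s \<otimes> c = c \<otimes> s" if "s \<in> S" "c \<in> C" for s c
    using that by (simp add: C_def centralizer_def)
  have K: "subgroup (S <#> C) G" "S \<subseteq> S <#> C" "C \<subseteq> S <#> C"
    using commuting_set_mult[OF Ss(1) Cs(1) com] by auto
  have KN: "S <#> C \<subseteq> N" using Ss(2) Cs(2) by (auto simp: set_mult_def)
  \<comment> \<open>The conjugates of \<open>S\<close> generate a normal subgroup of \<open>G\<close>, that is \<open>N\<close>; it remains to
    see that each of them is contained in \<open>S <#> C\<close>.\<close>
  define U where "U = (\<Union>g\<in>carrier G. (\<lambda>x. g \<otimes> x \<otimes> inv g) ` S)"
  have UK: "(\<lambda>x. g \<otimes> x \<otimes> inv g) ` S \<subseteq> S <#> C" if g: "g \<in> carrier G" for g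
  proof -
    define T where "T = (\<lambda>x. g \<otimes> x \<otimes> inv g) ` S"
    have Ts: "subgroup T G" unfolding T_def by (rule subgroup_conj_image[OF g Ss(1)])
    have TN: "T \<subseteq> N" using Ss(2) N.inv_op_closed2[OF g] by (auto simp: T_def)
    have Tn: "x \<otimes> t \<otimes> inv x \<in> T" if x: "x \<in> N" and t: "t \<in> T" for x t
    proof -
      obtain s where s: "s \<in> S" "t = g \<otimes> s \<otimes> inv g" using t by (auto simp: T_def)
      let ?y = "inv g \<otimes> x \<otimes> g"
      have y: "?y \<in> N" using N.inv_op_closed1[OF g x] .
      have "g \<otimes> ?y = x \<otimes> g" using g x by (simp add: m_assoc mult_inv_cancel_left)
      then have "x \<otimes> t \<otimes> inv x = (g \<otimes> ?y) \<otimes> s \<otimes> inv (g \<otimes> ?y)"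
        using conj_conj[of x g s] g x s by simp
      also have "\<dots> = g \<otimes> (?y \<otimes> s \<otimes> inv ?y) \<otimes> inv g"
        using g s(1) N.mem_carrier[OF y] by (subst conj_conj) simp_all
      finally show ?thesis using Sn[OF y s(1)] by (simp add: T_def)
    qed
    show ?thesis
    proof (cases "S \<inter> T = {\<one>}")
      case True
      have "t \<in> C" if t: "t \<in> T" for t
      proof -
        have tN: "t \<in> N" using t TN by blast
        have "t \<otimes> s = s \<otimes> t" if s: "s \<in> S" for s
        proof -
          have cr: "t \<in> carrier G" "s \<in> carrier G" using tN s by auto
          have sN: "s \<in> N" using s Ss(2) by blast
          \<comment> \<open>The commutator of \<open>t\<close> and \<open>s\<close> lies in both normal subgroups \<open>S\<close> and \<open>T\<close>.\<close>
          have "(t \<otimes> s \<otimes> inv t) \<otimes> inv s \<in> S" using Sn[OF tN s] s by simp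
          moreover have "t \<otimes> (s \<otimes> inv t \<otimes> inv s) \<in> T"
            using t Tn[OF sN subgroup.m_inv_closed[OF Ts t]] subgroup.m_closed[OF Ts] by blast
          then have "(t \<otimes> s \<otimes> inv t) \<otimes> inv s \<in> T" using cr by (simp add: m_assoc)
          ultimately have "(t \<otimes> s \<otimes> inv t) \<otimes> inv s = \<one>" using True by blast
          then have "(t \<otimes> s \<otimes> inv t) \<otimes> inv s \<otimes> s = s" using cr by simp
          then have "t \<otimes> s \<otimes> inv t = s" using cr by (simp add: m_assoc)
          then show ?thesis using conj_fixed_iff cr by simp
        qed
        then show ?thesis using tN by (simp add: C_def centralizer_def)
      qed
      then show ?thesis using K(3) by (auto simp: T_def)
    next
      case False
      have "S \<inter> T \<lhd> G\<lparr>carrier := N\<rparr>"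
        using subgroups_Inter_pair[OF Ss(1) Ts] Ss(2) Sn Tn by (auto simp: nrm)
      then have "S \<inter> T \<in> F" using False by (simp add: F_def)
      then have "S \<subseteq> T" using S(2) by blast
      moreover have "card T = card S" unfolding T_def by (rule card_conjugate[OF g S.subset])
      moreover have "finite T" using fin subgroup.subset[OF Ts] finite_subset by blast
      ultimately have "S = T" using card_subset_eq by metis
      then show ?thesis using K(2) by (auto simp: T_def)
    qed
  qed
  have UG: "U \<subseteq> carrier G" by (auto simp: U_def)
  have genG: "generate G U \<lhd> G"
  proof (rule normal_generateI[OF UG])
    fix h g assume h: "h \<in> U" and g: "g \<in> carrier G"
    obtain x s where x: "x \<in> carrier G" "s \<in> S" "h = x \<otimes> s \<otimes> inv x" using h by (auto simp: U_def)
    then have "g \<otimes> h \<otimes> inv g = (g \<otimes> x) \<otimes> s \<otimes> inv (g \<otimes> x)" using g by (simp add: conj_conj)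
    then show "g \<otimes> h \<otimes> inv g \<in> U" unfolding U_def using x g by blast
  qed
  have genK: "generate G U \<subseteq> S <#> C"
    by (rule generate_subgroup_incl[OF _ K(1)]) (use UK in \<open>auto simp: U_def\<close>)
  have "S \<subseteq> U"
  proof
    fix s assume "s \<in> S"
    then have "s = \<one> \<otimes> s \<otimes> inv \<one>" by simp
    then show "s \<in> U" unfolding U_def using \<open>s \<in> S\<close> by blast
  qed
  then have "S \<subseteq> generate G U" by (meson generate.incl subset_iff)
  then have "{\<one>} \<subset> generate G U" using SN(2) S.one_closed by blast
  then have "generate G U = N" using min[OF genG] genK KN by blast
  then have SC: "S <#> C = N" using genK KN by blast
  have tr: "S \<inter> C = {\<one>}"
  proof -
    have "x = \<one>" if x: "x \<in> S \<inter> C" for x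
    proof -
      have "x \<otimes> n = n \<otimes> x" if n: "n \<in> N" for n
      proof -
        obtain s c where sc: "s \<in> S" "c \<in> C" "n = s \<otimes> c" using n SC by (auto simp: set_mult_def)
        have cr: "x \<in> carrier G" "s \<in> carrier G" "c \<in> carrier G" using x sc Cs N.subset by auto
        have "x \<otimes> n = (x \<otimes> s) \<otimes> c" using sc cr by (simp add: m_assoc)
        also have "\<dots> = (s \<otimes> x) \<otimes> c" using com[of s x] sc(1) x by simp
        also have "\<dots> = s \<otimes> (x \<otimes> c)" using cr by (simp add: m_assoc)
        also have "\<dots> = n \<otimes> x" using com[of x c] sc x cr by (simp add: m_assoc)
        finally show ?thesis .
      qed
      then have "x \<in> N \<inter> centralizer G N" using x Ss by (auto simp: centralizer_def)
      then show ?thesis using Z by simp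
    qed
    then show ?thesis using S.one_closed subgroup.one_closed[OF Cs(1)] by blast
  qed
  have simple: "L = {\<one>} \<or> L = S" if L: "L \<lhd> G\<lparr>carrier := S\<rparr>" for L
  proof -
    note l = L[unfolded normal_in_iff[OF Ss(1)]]
    have "n \<otimes> x \<otimes> inv n \<in> L" if n: "n \<in> N" and x: "x \<in> L" for n x
    proof -
      obtain s c where sc: "s \<in> S" "c \<in> C" "n = s \<otimes> c" using n SC by (auto simp: set_mult_def)
      have xS: "x \<in> S" using l x by blast
      have cr: "x \<in> carrier G" "s \<in> carrier G" "c \<in> carrier G" using xS sc Cs N.subset by auto
      have "c \<otimes> x \<otimes> inv c = x" using com[OF xS sc(2)] conj_fixed_iff cr by simp
      then have "n \<otimes> x \<otimes> inv n = s \<otimes> x \<otimes> inv s" using sc cr conj_conj[of s c x] by simp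
      then show ?thesis using l sc x by simp
    qed
    then have "L \<lhd> G\<lparr>carrier := N\<rparr>" using l Ss by (auto simp: nrm)
    then show ?thesis using S(2) l by (auto simp: F_def)
  qed
  show ?thesis by (rule that[OF SN(1) CN SN(2) tr SC com simple])
qed

lemma (in normal) pow_index_mem:
  assumes fin: "finite (carrier G)" and card: "order G = m * card H" and x: "x \<in> carrier G"
  shows "x [^] m \<in> H"
proof -
  interpret Q: group "G Mod H" by (rule factorgroup_is_group)
  have "card (rcosets H) * card H = m * card H" using lagrange[OF subgroup_axioms] card by simp
  moreover have "card H > 0" using finite_imp_card_positive[OF fin] .
  ultimately have m: "order (G Mod H) = m" by (simp add: order_def FactGroup_def)
  have "H #> x \<in> carrier (G Mod H)" using x by (simp add: carrier_FactGroup)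
  then have "(H #> x) [^]\<^bsub>G Mod H\<^esub> m = H" using Q.pow_order_eq_1 m by force
  then have "H #> (x [^] m) = H" using FactGroup_pow[OF x] by simp
  then show ?thesis using x rcos_self[OF _ subgroup_axioms, of "x [^] m"] by simp
qed

text \<open>If \<open>p\<close> divides the order of a chief factor \<open>H / K\<close>, then \<open>K\<close> and the elements of \<open>p\<close>-power
  order generate \<open>H\<close>, because they generate a normal subgroup of \<open>G\<close>. All of them lie in any
  normal subgroup \<open>L \<supseteq> K\<close> of \<open>H\<close> whose index is prime to \<open>p\<close>. For \<open>K\<close> trivial this says
  that a minimal normal subgroup is the normal closure in itself of each Sylow \<open>p\<close>-subgroup.\<close>

lemma (in group) chief_factor_normal_prime_index:
  assumes fin: "finite (carrier G)" and HK: "chief_factor G H K"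
    and p: "Factorial_Ring.prime p" and n: "card H = n * card K" "p dvd n"
    and L: "L \<lhd> G\<lparr>carrier := H\<rparr>" "K \<subseteq> L" and m: "card H = m * card L" "\<not> p dvd m"
  shows "L = H"
proof -
  have HG: "H \<lhd> G" and KG: "K \<lhd> G" and KH: "K \<subset> H"
    and min: "\<And>L. L \<lhd> G \<Longrightarrow> K \<subset> L \<Longrightarrow> L \<subset> H \<Longrightarrow> False"
    using HK by (auto simp: chief_factor_def)
  interpret H: normal H G by (rule HG)
  interpret K: normal K G by (rule KG)
  have Hs: "subgroup H G" by (rule H.subgroup_axioms)
  interpret GH: group "G\<lparr>carrier := H\<rparr>" by (rule subgroup_imp_group[OF Hs])
  interpret L: normal L "G\<lparr>carrier := H\<rparr>" by (rule L)
  have Ls: "subgroup L G" "L \<subseteq> H" using L(1) by (auto simp: normal_in_iff[OF Hs])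
  interpret Lg: subgroup L G by (rule Ls)
  have finH: "finite H" using fin H.subset finite_subset by blast
  define U where "U = K \<union> {x \<in> H. \<exists>k::nat. x [^] (p ^ k) = \<one>}"
  have powH: "x [^]\<^bsub>G\<lparr>carrier := H\<rparr>\<^esub> k = x [^] k" for x and k :: nat
    by (simp add: nat_pow_def)
  have "x \<in> L" if x: "x \<in> H" "x [^] (p ^ k) = \<one>" for x and k :: nat
  proof -
    have xG: "x \<in> carrier G" using x by simp
    have xm: "x [^] m \<in> L"
      using L.pow_index_mem[of m x] finH m(1) x by (simp add: order_def powH)
    have "coprime (p ^ k) m" using p m(2) by (simp add: prime_imp_coprime)
    then obtain u v where "int (p ^ k) * u + int m * v = 1"
      by (metis coprime_iff_gcd_eq_1 bezout_int gcd_int_int_eq of_nat_1 mult.commute)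
    then have "x = x [^] (int (p ^ k) * u + int m * v)" using xG by simp
    also have "\<dots> = (x [^] int (p ^ k)) [^] u \<otimes> (x [^] int m) [^] v"
      using xG by (simp add: int_pow_mult int_pow_pow)
    also have "\<dots> = (x [^] m) [^] v" using xG x(2) by (simp only: int_pow_int) simp
    finally have "x = (x [^] m) [^] v" .
    moreover have "(x [^] m) [^] v \<in> L" by (rule subgroup_int_pow_closed[OF Ls(1) xm])
    ultimately show ?thesis by simp
  qed
  then have UL: "U \<subseteq> L" using L(2) by (auto simp: U_def)
  have UG: "U \<subseteq> carrier G" using UL by auto
  have genG: "generate G U \<lhd> G"
  proof (rule normal_generateI[OF UG])
    fix h g assume h: "h \<in> U" and g: "g \<in> carrier G"
    show "g \<otimes> h \<otimes> inv g \<in> U"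
    proof (cases "h \<in> K")
      case True then show ?thesis using K.inv_op_closed2[OF g] by (simp add: U_def)
    next
      case False
      then obtain k :: nat where k: "h \<in> H" "h [^] (p ^ k) = \<one>" using h by (auto simp: U_def)
      have cp: "(g \<otimes> h \<otimes> inv g) [^] j = g \<otimes> h [^] j \<otimes> inv g" for j :: nat
        using g k(1) by (induction j) (simp_all add: conj_mult)
      show ?thesis using cp[of "p ^ k"] k g H.inv_op_closed2[OF g k(1)] by (auto simp: U_def)
    qed
  qed
  have genL: "generate G U \<subseteq> L" by (rule generate_subgroup_incl[OF UL Ls(1)])
  have Kgen: "K \<subseteq> generate G U" by (auto simp: U_def intro: generate.incl)
  have "generate G U \<noteq> K"
  proof
    assume eq: "generate G U = K"
    \<comment> \<open>Otherwise \<open>K\<close> contains a Sylow \<open>p\<close>-subgroup of \<open>H\<close>, although its index is divisible by \<open>p\<close>.\<close>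
    define a where "a = multiplicity p (card H)"
    have H0: "card H \<noteq> 0" using finH H.one_closed card_0_eq by blast
    have "p ^ a dvd card H" by (simp add: a_def multiplicity_dvd)
    then obtain m' where m': "card H = p ^ a * m'" by blast
    obtain P where P: "subgroup P (G\<lparr>carrier := H\<rparr>)" "card P = p ^ a"
      using sylow_thm[OF p GH.group_axioms, of a m'] m' finH by (auto simp: order_def)
    have Ps: "subgroup P G" "P \<subseteq> H"
      using incl_subgroup[OF Hs P(1)] subgroup.subset[OF P(1)] by auto
    interpret GP: group "G\<lparr>carrier := P\<rparr>" by (rule subgroup_imp_group[OF Ps(1)])
    have "P \<subseteq> U"
    proof
      fix x assume x: "x \<in> P"
      have "x [^]\<^bsub>G\<lparr>carrier := P\<rparr>\<^esub> order (G\<lparr>carrier := P\<rparr>) = \<one>"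
        using GP.pow_order_eq_1[of x] x by simp
      then have "x [^] (p ^ a) = \<one>" using P(2) by (simp add: order_def nat_pow_def)
      then show "x \<in> U" using x Ps by (auto simp: U_def)
    qed
    then have "P \<subseteq> generate G U" by (auto intro: generate.incl)
    then have "P \<subseteq> K" using eq by simp
    then have "p ^ a dvd card K"
      using card_subgroup_dvd[OF Ps(1) K.subgroup_axioms] P(2) by simp
    then have "p * p ^ a dvd card H" unfolding n(1) using n(2) by (rule mult_dvd_mono[rotated])
    then have "p ^ Suc a dvd card H" by simp
    then have "Suc a \<le> a" unfolding a_def using H0 p
      by (metis multiplicity_geI not_prime_unit prime_elem_def prime_imp_prime_elem)
    then show False by simp
  qed
  then have "K \<subset> generate G U" using Kgen by blast
  then have "generate G U = H" using min[OF genG] genL Ls(2) by blast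
  then show ?thesis using genL Ls(2) by blast
qed

text \<open>In an abelian group the Sylow \<open>p\<close>-subgroup is normal of index prime to \<open>p\<close>.\<close>

lemma (in group) chief_factor_prime_dvd_imp_prime_power:
  assumes fin: "finite (carrier G)" and N: "chief_factor G N {\<one>}"
    and comm: "\<And>x y. x \<in> N \<Longrightarrow> y \<in> N \<Longrightarrow> x \<otimes> y = y \<otimes> x"
    and p: "Factorial_Ring.prime p" "p dvd card N"
  shows "\<exists>k. card N = p ^ k"
proof -
  have Ns: "subgroup N G" using N normal_imp_subgroup by (auto simp: chief_factor_def)
  interpret N: subgroup N G by (rule Ns)
  interpret GN: group "G\<lparr>carrier := N\<rparr>" by (rule subgroup_imp_group[OF Ns])
  have finN: "finite N" using fin N.subset finite_subset by blast
  then have c0: "card N \<noteq> 0" using N.one_closed card_0_eq by blast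
  obtain m where m: "card N = p ^ multiplicity p (card N) * m" "\<not> p dvd m"
    using multiplicity_decompose'[OF c0] p(1) not_prime_unit by metis
  obtain P where P: "subgroup P (G\<lparr>carrier := N\<rparr>)" "card P = p ^ multiplicity p (card N)"
    using sylow_thm[OF p(1) GN.group_axioms, of _ m] m(1) finN by (auto simp: order_def)
  have Ps: "subgroup P G" "P \<subseteq> N" using incl_subgroup[OF Ns P(1)] subgroup.subset[OF P(1)] by auto
  have "P \<lhd> G\<lparr>carrier := N\<rparr>"
    unfolding normal_in_iff[OF Ns]
  proof (intro conjI Ps ballI)
    fix x y assume xy: "x \<in> N" "y \<in> P"
    then have "x \<otimes> y \<otimes> inv x = y" using comm[of x y] conj_fixed_iff[of x y] Ps(2) by auto
    then show "x \<otimes> y \<otimes> inv x \<in> P" using xy by simp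
  qed
  moreover have "card N = m * card P" using m(1) P(2) by (metis mult.commute)
  moreover have "card N = card N * card {\<one>}" "{\<one>} \<subseteq> P" using subgroup.one_closed[OF Ps(1)] by simp_all
  ultimately have "P = N"
    using chief_factor_normal_prime_index[OF fin N p(1) _ p(2)] m(2) by blast
  then show ?thesis using P(2) by blast
qed

section \<open>Minimal normal subgroups and short chains\<close>

text \<open>The case of a simple group. Let \<open>P\<close> have order \<open>p\<close>, the least prime factor of the group order,
  and let \<open>T\<close> be its normalizer, which centralizes \<open>P\<close>. If \<open>T \<noteq> P\<close>, the chain condition leaves room
  for nothing strictly between \<open>P\<close> and \<open>T\<close> or between \<open>T\<close> and \<open>G\<close>, so \<open>T\<close> is abelian and it
  is the centralizer of each of its nontrivial elements, as \<open>G\<close> has trivial centre. In both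
  cases \<open>T\<close> is abelian and meets its other conjugates trivially, and the transfer produces
  a normal subgroup.\<close>

lemma (in group) simple_no_long_chain_imp_commute:
  assumes fin: "finite (carrier G)"
    and simple: "\<And>L. L \<lhd> G \<Longrightarrow> L = {\<one>} \<or> L = carrier G"
    and nochain: "\<And>A B C. \<lbrakk>subgroup A G; subgroup B G; subgroup C G; A \<noteq> {\<one>}; A \<subset> B; B \<subset> C; C \<subset> carrier G\<rbrakk> \<Longrightarrow> False"
    and xy: "x \<in> carrier G" "y \<in> carrier G"
  shows "x \<otimes> y = y \<otimes> x"
proof (rule ccontr)
  assume ne: "x \<otimes> y \<noteq> y \<otimes> x"
  define Z where "Z = centralizer G (carrier G)"
  have "Z \<lhd> G" unfolding Z_def
    by (rule normal_invI[OF subgroup_centralizer])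
      (auto intro!: conj_in_centralizer)
  moreover have "Z \<noteq> carrier G" using ne xy by (auto simp: Z_def centralizer_def)
  ultimately have Z1: "Z = {\<one>}" using simple by blast
  have cent1: "centralizer G {b} \<noteq> carrier G" if "b \<in> carrier G" "b \<noteq> \<one>" for b
  proof
    assume eq: "centralizer G {b} = carrier G"
    have "g \<otimes> b = b \<otimes> g" if g: "g \<in> carrier G" for g
    proof -
      have "g \<in> centralizer G {b}" using g eq by simp
      then show ?thesis by (simp add: centralizer_def)
    qed
    then have "b \<in> Z" using \<open>b \<in> carrier G\<close> by (simp add: Z_def centralizer_def)
    then show False using Z1 that(2) by simp
  qed
  have "order G \<noteq> 1"
  proof
    assume "order G = 1"
    then have "carrier G = {\<one>}" using order_one_triv_iff by blast
    then show False using ne xy by simp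
  qed
  then have ex: "\<exists>p. Factorial_Ring.prime p \<and> p dvd order G" using prime_factor_nat by blast
  define p where "p = (LEAST p. Factorial_Ring.prime p \<and> p dvd order G)"
  have p: "Factorial_Ring.prime p" "p dvd order G" using LeastI_ex[OF ex] by (auto simp: p_def)
  have least: "p \<le> q" if "Factorial_Ring.prime q" "q dvd order G" for q
    unfolding p_def by (rule Least_le) (use that in simp)
  obtain m where m: "order G = p ^ 1 * m" using p(2) by (metis dvdE power_one_right)
  obtain P where P: "subgroup P G" "card P = p"
    using sylow_thm[OF p(1) group_axioms m fin] by (metis power_one_right)
  interpret P: subgroup P G by (rule P)
  have Pp: "Factorial_Ring.prime (card P)" using P(2) p(1) by simp
  have Pn1: "P \<noteq> {\<one>}" using P(2) p(1) by auto
  define T where "T = normalizer G P"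
  have T: "subgroup T G" "P \<subseteq> T" unfolding T_def by (rule normalizer_superset[OF fin P(1)])+
  interpret T: subgroup T G by (rule T)
  have central: "y \<otimes> x = x \<otimes> y" if "x \<in> P" "y \<in> T" for x y
    using least_prime_subgroup_central_in_normalizer[OF fin p(1) least P that[unfolded T_def]] .
  have Tn: "T \<noteq> carrier G"
  proof
    assume TG: "T = carrier G"
    obtain x where x: "x \<in> P" "x \<noteq> \<one>" using Pn1 P.one_closed by blast
    have "x \<otimes> y = y \<otimes> x" if "y \<in> carrier G" for y
      using central[OF x(1), of y] TG that by simp
    then have "x \<in> Z" using x(1) by (simp add: Z_def centralizer_def)
    then show False using Z1 x by simp
  qed
  have TG: "T \<subset> carrier G" using Tn T.subset by blast
  have Tcom: "x \<otimes> y = y \<otimes> x" if xy: "x \<in> T" "y \<in> T" for x y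
  proof -
    \<comment> \<open>\<open>D\<close> contains \<open>P\<close> and \<open>y\<close>, and there is no room for it strictly between \<open>P\<close> and \<open>T\<close>.\<close>
    define D where "D = T \<inter> centralizer G {y}"
    have D: "subgroup D G" unfolding D_def
      using subgroups_Inter_pair[OF T(1) subgroup_centralizer[of "{y}"]] xy by simp
    have PD: "P \<subseteq> D" using central[OF _ xy(2)] T by (auto simp: D_def centralizer_def)
    have "D = T"
    proof (rule ccontr)
      assume "D \<noteq> T"
      then have DT: "D \<subset> T" by (auto simp: D_def)
      then have "D = P" using nochain[OF P(1) D T(1) Pn1 _ DT TG] PD by blast
      moreover have "y \<in> D" using xy by (simp add: D_def centralizer_def)
      ultimately have yP: "y \<in> P" by simp
      have "T \<subseteq> D"
      proof
        fix z assume z: "z \<in> T"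
        then show "z \<in> D" using central[OF yP z] by (simp add: D_def centralizer_def)
      qed
      then show False using DT by blast
    qed
    then have "x \<in> D" using xy(1) by simp
    then have "x \<in> centralizer G {y}" by (simp add: D_def)
    then show ?thesis by (simp add: centralizer_def)
  qed
  have ti: "a = \<one>" if g: "g \<in> carrier G - T" and a: "a \<in> T" and b: "g \<otimes> a \<otimes> inv g \<in> T" for g a
  proof (rule ccontr)
    assume a1: "a \<noteq> \<one>"
    have gG: "g \<in> carrier G" using g by simp
    show False
    proof (cases "P = T")
      case True
      have "\<forall>x\<in>P. g \<otimes> x \<otimes> inv g \<in> P"
        using prime_card_subgroup_conj[OF P(1) Pp gG] a b a1 True by blast
      then show False using g mem_normalizer_iff[OF fin P.subset] by (simp add: T_def)
    next
      case False
      then have PT: "P \<subset> T" using T(2) by blast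
      define b where "b = g \<otimes> a \<otimes> inv g"
      have bT: "b \<in> T" using b by (simp add: b_def)
      have b1: "b \<noteq> \<one>"
        using conj_eq_one_iff[OF gG, of a] a a1 by (simp add: b_def)
      \<comment> \<open>\<open>D\<close> contains \<open>T\<close> and its conjugate under \<open>g\<close>, and \<open>T\<close> is maximal in \<open>G\<close> for lack of
        room, so \<open>g\<close> normalizes \<open>T\<close>.\<close>
      define D where "D = centralizer G {b}"
      have D: "subgroup D G" unfolding D_def using subgroup_centralizer[of "{b}"] bT by simp
      have TD: "T \<subseteq> D" using Tcom[OF _ bT] by (auto simp: D_def centralizer_def)
      have DG: "D \<subset> carrier G" using cent1[OF _ b1] bT subgroup.subset[OF D] by (auto simp: D_def)
      have "D = T" using nochain[OF P(1) T(1) D Pn1 PT _ DG] TD by blast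
      have "g \<otimes> t \<otimes> inv g \<in> T" if t: "t \<in> T" for t
      proof -
        have "(g \<otimes> t \<otimes> inv g) \<otimes> b = b \<otimes> (g \<otimes> t \<otimes> inv g)"
          unfolding b_def using gG a t Tcom[OF t a] by (simp add: conj_mult[symmetric])
        then have "g \<otimes> t \<otimes> inv g \<in> D" using gG t by (simp add: D_def centralizer_def)
        then show ?thesis using \<open>D = T\<close> by simp
      qed
      then have gR: "g \<in> normalizer G T" using mem_normalizer_iff[OF fin T.subset] gG by simp
      have R: "subgroup (normalizer G T) G" "T \<subseteq> normalizer G T"
        by (rule normalizer_superset[OF fin T(1)])+
      have "normalizer G T \<noteq> carrier G"
        using normalizer_superset(3)[OF fin T(1)] simple[of T] Tn PT P.one_closed by blast
      then have "normalizer G T \<subset> carrier G" using subgroup.subset[OF R(1)] by blast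
      then have "normalizer G T = T" using nochain[OF P(1) T(1) R(1) Pn1 PT] R(2) by blast
      then show False using gR g by simp
    qed
  qed
  have "T \<noteq> {\<one>}" using T(2) Pn1 P.one_closed by blast
  then have "\<exists>K. K \<lhd> G \<and> K \<noteq> {\<one>} \<and> K \<noteq> carrier G"
    by (rule abelian_TI_subgroup_imp_normal_subgroup[OF fin T(1) _ Tn]) (assumption | fact Tcom ti)+
  then show False using simple by blast
qed

text \<open>The case of a proper minimal normal subgroup \<open>N\<close>. A nonabelian \<open>N\<close> is a product of commuting
  subgroups \<open>S\<close> and \<open>C\<close> with \<open>S\<close> simple; let \<open>P1\<close> and \<open>P2\<close> be Sylow \<open>p\<close>-subgroups of them, with \<open>p\<close>
  dividing the order of \<open>S\<close>, and \<open>P = P1 <#> P2\<close>. By the Frattini argument a maximal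
  subgroup \<open>M1\<close> above the normalizer of \<open>P\<close> does not contain \<open>N\<close>. The condition \<open>deep\<close> says
  that subgroups two steps below \<open>M1\<close> have a small trace on \<open>N\<close>. Since neither \<open>P\<close> nor \<open>E <#> P2\<close>
  with \<open>E \<noteq> {\<one>}\<close> lies in a proper normal subgroup of \<open>N\<close>, this forces \<open>P = M1 \<inter> N\<close> and then that
  \<open>P1\<close> has order \<open>p\<close>. Moreover \<open>P1\<close> is self-normalizing in \<open>S\<close>, which contradicts the
  simplicity of \<open>S\<close> by transfer.\<close>

lemma (in group) proper_minimal_normal_abelian:
  assumes fin: "finite (carrier G)" and N: "chief_factor G N {\<one>}" and NG: "N \<noteq> carrier G"
    and deep: "\<And>M1 U Y. \<lbrakk>maximal_subgroup G M1; \<not> N \<subseteq> M1; subgroup U G; subgroup Y G; U \<subset> Y; Y \<subset> M1\<rbrakk> \<Longrightarrow>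
      \<exists>L. L \<lhd> G\<lparr>carrier := N\<rparr> \<and> L \<noteq> N \<and> U \<inter> N \<subseteq> L"
    and xy: "x \<in> N" "y \<in> N"
  shows "x \<otimes> y = y \<otimes> x"
proof (rule ccontr)
  assume ne: "x \<otimes> y \<noteq> y \<otimes> x"
  have Nn: "N \<lhd> G" and N1: "{\<one>} \<subset> N" and min: "\<And>L. L \<lhd> G \<Longrightarrow> {\<one>} \<subset> L \<Longrightarrow> L \<subset> N \<Longrightarrow> False"
    using N by (auto simp: chief_factor_def)
  interpret N: normal N G by (rule Nn)
  have Ns: "subgroup N G" by (rule N.subgroup_axioms)
  interpret GN: group "G\<lparr>carrier := N\<rparr>" by (rule subgroup_imp_group[OF Ns])
  note nrm = normal_in_iff[OF Ns]
  have finsub: "finite A" if "subgroup A G" for A using fin subgroup.subset[OF that] finite_subset by blast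
  have card0: "card A \<noteq> 0" if "subgroup A G" for A
    using finsub[OF that] subgroup.one_closed[OF that] card_0_eq by blast
  have Z: "N \<inter> centralizer G N = {\<one>}"
  proof (rule ccontr)
    assume Zne: "N \<inter> centralizer G N \<noteq> {\<one>}"
    have Zs: "subgroup (N \<inter> centralizer G N) G"
      by (rule subgroups_Inter_pair[OF Ns subgroup_centralizer[OF N.subset]])
    have "N \<inter> centralizer G N \<lhd> G"
    proof (rule normal_invI[OF Zs])
      fix g h assume g: "g \<in> carrier G" and h: "h \<in> N \<inter> centralizer G N"
      have "g \<otimes> h \<otimes> inv g \<in> centralizer G N"
        by (rule conj_in_centralizer[OF g N.subset]) (use N.inv_op_closed1[OF g] h in auto)
      then show "g \<otimes> h \<otimes> inv g \<in> N \<inter> centralizer G N" using N.inv_op_closed2[OF g] h by blast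
    qed
    moreover have "{\<one>} \<subset> N \<inter> centralizer G N" using Zne subgroup.one_closed[OF Zs] by blast
    ultimately have "N \<inter> centralizer G N = N" using min by blast
    then have "x \<in> centralizer G N" using xy by blast
    then show False using ne xy by (simp add: centralizer_def)
  qed
  have Zel: "z = \<one>" if "z \<in> N" "\<And>n. n \<in> N \<Longrightarrow> z \<otimes> n = n \<otimes> z" for z
  proof -
    have "z \<in> N \<inter> centralizer G N" using that by (auto simp: centralizer_def)
    then show ?thesis using Z by simp
  qed
  obtain S C where SN: "S \<lhd> G\<lparr>carrier := N\<rparr>" and CN: "C \<lhd> G\<lparr>carrier := N\<rparr>" and S1: "S \<noteq> {\<one>}"
    and tr: "S \<inter> C = {\<one>}" and SC: "S <#> C = N"
    and com: "\<And>s c. s \<in> S \<Longrightarrow> c \<in> C \<Longrightarrow> s \<otimes> c = c \<otimes> s"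
    and simple: "\<And>L. L \<lhd> G\<lparr>carrier := S\<rparr> \<Longrightarrow> L = {\<one>} \<or> L = S"
    using minimal_normal_direct_decomposition[OF fin N Z] by blast
  have Ss: "subgroup S G" "S \<subseteq> N" and Cs: "subgroup C G" "C \<subseteq> N"
    using SN CN by (auto simp: nrm)
  interpret S: subgroup S G by (rule Ss)
  interpret C: subgroup C G by (rule Cs)
  interpret GS: group "G\<lparr>carrier := S\<rparr>" by (rule subgroup_imp_group[OF Ss(1)])
  interpret GC: group "G\<lparr>carrier := C\<rparr>" by (rule subgroup_imp_group[OF Cs(1)])
  have "card S \<noteq> 1" using S1 S.one_closed by (metis card_1_singletonE singletonD)
  then obtain p where p: "Factorial_Ring.prime p" "p dvd card S" using prime_factor_nat by blast
  define a where "a = multiplicity p (card S)"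
  define b where "b = multiplicity p (card C)"
  have p_unit: "\<not> is_unit p" using p(1) not_prime_unit by blast
  obtain m1 where m1: "card S = p ^ a * m1" "\<not> p dvd m1"
    using multiplicity_decompose'[OF card0[OF Ss(1)] p_unit] unfolding a_def by metis
  obtain m2 where m2: "card C = p ^ b * m2" "\<not> p dvd m2"
    using multiplicity_decompose'[OF card0[OF Cs(1)] p_unit] unfolding b_def by metis
  have a0: "a \<noteq> 0" using m1 p(2) by (metis mult_1 power_0)
  obtain P1 where P1: "subgroup P1 (G\<lparr>carrier := S\<rparr>)" "card P1 = p ^ a"
    using sylow_thm[OF p(1) GS.group_axioms, of a m1] m1(1) finsub[OF Ss(1)] by (auto simp: order_def)
  obtain P2 where P2: "subgroup P2 (G\<lparr>carrier := C\<rparr>)" "card P2 = p ^ b"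
    using sylow_thm[OF p(1) GC.group_axioms, of b m2] m2(1) finsub[OF Cs(1)] by (auto simp: order_def)
  have P1s: "subgroup P1 G" "P1 \<subseteq> S"
    using incl_subgroup[OF Ss(1) P1(1)] subgroup.subset[OF P1(1)] by auto
  have P2s: "subgroup P2 G" "P2 \<subseteq> C"
    using incl_subgroup[OF Cs(1) P2(1)] subgroup.subset[OF P2(1)] by auto
  interpret P1: subgroup P1 G by (rule P1s)
  interpret P2: subgroup P2 G by (rule P2s)
  have prod: "subgroup (E <#> P2) G" "E \<subseteq> E <#> P2" "P2 \<subseteq> E <#> P2" "card (E <#> P2) = card E * p ^ b"
    if E: "subgroup E G" "E \<subseteq> P1" for E
  proof -
    have c: "s \<otimes> c = c \<otimes> s" if "s \<in> E" "c \<in> P2" for s c using that E P1s P2s com by blast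
    have "E \<inter> P2 = {\<one>}" using tr E P1s P2s subgroup.one_closed[OF E(1)] P2.one_closed by blast
    then show "subgroup (E <#> P2) G" "E \<subseteq> E <#> P2" "P2 \<subseteq> E <#> P2" "card (E <#> P2) = card E * p ^ b"
      using commuting_set_mult[OF E(1) P2s(1) c] P2(2) by auto
  qed
  \<comment> \<open>By the choice of \<open>P1\<close> and \<open>P2\<close> this is a Sylow \<open>p\<close>-subgroup of \<open>N\<close>.\<close>
  define P where "P = P1 <#> P2"
  have P: "subgroup P G" "P1 \<subseteq> P" "P2 \<subseteq> P" "card P = p ^ (a + b)"
    using prod[OF P1s(1)] P1(2) by (auto simp: P_def power_add)
  interpret P: subgroup P G by (rule P)
  have PN: "P \<subseteq> N" using P1s P2s SC mono_set_mult[of P1 S P2 C G] by (simp add: P_def)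
  have cardN: "card N = p ^ (a + b) * (m1 * m2)"
    using card_commuting_set_mult[OF Ss(1) Cs(1) com tr] SC m1(1) m2(1) by (simp add: power_add)
  have pm: "\<not> p dvd m1 * m2" using m1 m2 p(1) prime_dvd_mult_iff by blast
  have p_pos: "p ^ k > 0" for k using p(1) by (simp add: prime_gt_0_nat)
  \<comment> \<open>No proper normal subgroup of \<open>N\<close> contains \<open>P\<close>, so by \<open>deep\<close> there is no subgroup strictly
    between \<open>P\<close> and a maximal subgroup of \<open>G\<close> that does not contain \<open>N\<close>.\<close>
  have full: "L = N" if L: "L \<lhd> G\<lparr>carrier := N\<rparr>" "P \<subseteq> L" for L
  proof -
    have Ls: "subgroup L G" "L \<subseteq> N" using L(1) by (auto simp: nrm)
    obtain m where m: "card N = m * card L" using card_subgroup_dvd[OF Ls(1) Ns Ls(2)] by (metis dvdE mult.commute)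
    obtain j where j: "card L = p ^ (a + b) * j" using card_subgroup_dvd[OF P(1) Ls(1) L(2)] P(4) by auto
    have "p ^ (a + b) * (m * j) = m * card L" by (simp add: j)
    also have "\<dots> = p ^ (a + b) * (m1 * m2)" using m cardN by metis
    finally have "p ^ (a + b) * (m * j) = p ^ (a + b) * (m1 * m2)" .
    then have "m * j = m1 * m2" using p_pos[of "a + b"] by (metis mult_cancel1 less_irrefl)
    then have "\<not> p dvd m" using pm by (metis dvd_mult2)
    moreover have "p dvd card N" using a0 by (simp add: cardN)
    ultimately show ?thesis
      using chief_factor_normal_prime_index[OF fin N p(1), of "card N" L m] m L(1) subgroup.one_closed[OF Ls(1)]
      by simp
  qed
  define T where "T = normalizer G P"
  have T: "subgroup T G" "P \<subseteq> T" unfolding T_def by (rule normalizer_superset[OF fin P(1)])+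
  have Tmem: "g \<in> T \<longleftrightarrow> g \<in> carrier G \<and> (\<forall>x\<in>P. g \<otimes> x \<otimes> inv g \<in> P)" for g
    unfolding T_def by (rule mem_normalizer_iff[OF fin P.subset])
  \<comment> \<open>Otherwise the minimality of \<open>N\<close> makes \<open>N = P\<close> a \<open>p\<close>-group, whose centre is nontrivial.\<close>
  have Tn: "T \<noteq> carrier G"
  proof
    assume "T = carrier G"
    then have "P \<lhd> G" using normalizer_superset(3)[OF fin P(1)] by (simp add: T_def)
    moreover have "card P \<noteq> 1" using P(4) a0 p(1) by (metis add_is_0 nat_power_eq_Suc_0_iff One_nat_def not_prime_1)
    then have "{\<one>} \<subset> P" using P.one_closed by auto
    ultimately have "P = N" using min[of P] PN by blast
    then have "order (G\<lparr>carrier := N\<rparr>) = p ^ (a + b)" using P(4) by (simp add: order_def)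
    then obtain z where z: "z \<in> N" "z \<noteq> \<one>" "\<forall>g\<in>N. g \<otimes> z = z \<otimes> g"
      using GN.p_group_central_element[OF p(1), of "a + b"] a0 by auto
    then show False using Zel[of z] by simp
  qed
  then have "T \<subset> carrier G" using subgroup.subset[OF T(1)] by blast
  then obtain M1 where "maximal_subgroup (G\<lparr>carrier := carrier G\<rparr>) M1" and TM: "T \<subseteq> M1"
    using exists_maximal_above[OF fin T(1) subgroup_self] by blast
  then have M1: "maximal_subgroup G M1" by simp
  have M1s: "subgroup M1 G" "M1 \<noteq> carrier G" using M1 by (auto simp: maximal_subgroup_def)
  \<comment> \<open>The Frattini argument: \<open>N\<close> and \<open>T\<close> generate \<open>G\<close>.\<close>
  have NM: "\<not> N \<subseteq> M1"
  proof
    assume NM: "N \<subseteq> M1"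
    have "g \<in> M1" if g: "g \<in> carrier G" for g
    proof -
      define Q where "Q = (\<lambda>x. g \<otimes> x \<otimes> inv g) ` P"
      have Qs: "subgroup Q G" unfolding Q_def by (rule subgroup_conj_image[OF g P(1)])
      have QN: "Q \<subseteq> N" using PN N.inv_op_closed2[OF g] by (auto simp: Q_def)
      have Qc: "card Q = p ^ (a + b)" using card_conjugate[OF g P.subset] P(4) by (simp add: Q_def)
      obtain n where n: "n \<in> N" "Q = (\<lambda>x. n \<otimes> x \<otimes> inv\<^bsub>G\<lparr>carrier := N\<rparr>\<^esub> n) ` P"
        using GN.sylow_conjugate[OF _ p(1), of "a + b" "m1 * m2" P Q] finsub[OF Ns] cardN pm
          subgroup_incl[OF P(1) Ns PN] subgroup_incl[OF Qs Ns QN] P(4) Qc by (auto simp: order_def)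
      have Qn: "Q = (\<lambda>x. n \<otimes> x \<otimes> inv n) ` P" using n m_inv_consistent[OF Ns] by simp
      have nG: "n \<in> carrier G" using n by simp
      have "inv n \<otimes> g \<in> T"
        unfolding Tmem
      proof (intro conjI ballI)
        fix x assume x: "x \<in> P"
        then have "g \<otimes> x \<otimes> inv g \<in> Q" by (simp add: Q_def)
        then obtain z where z: "z \<in> P" "g \<otimes> x \<otimes> inv g = n \<otimes> z \<otimes> inv n" unfolding Qn by blast
        have "(inv n \<otimes> g) \<otimes> x \<otimes> inv (inv n \<otimes> g) = inv n \<otimes> (g \<otimes> x \<otimes> inv g) \<otimes> inv (inv n)"
          using conj_conj[of "inv n" g x] g nG x by simp
        also have "\<dots> = z" unfolding z(2) using conj_conj[of "inv n" n z] nG z(1) by simp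
        finally show "(inv n \<otimes> g) \<otimes> x \<otimes> inv (inv n \<otimes> g) \<in> P" using z(1) by simp
      qed (use g nG in simp)
      then have "n \<otimes> (inv n \<otimes> g) \<in> M1" using subgroup.m_closed[OF M1s(1)] n(1) NM TM by blast
      then show ?thesis using g nG by (simp add: mult_inv_cancel_left)
    qed
    then show False using M1s subgroup.subset[OF M1s(1)] by blast
  qed
  define Y where "Y = M1 \<inter> N"
  have Ys: "subgroup Y G" unfolding Y_def by (rule subgroups_Inter_pair[OF M1s(1) Ns])
  have PY: "P \<subseteq> Y" using T(2) TM PN by (auto simp: Y_def)
  have YM: "Y \<subset> M1"
  proof -
    have "Y \<noteq> M1"
    proof
      assume "Y = M1"
      then have "M1 \<subseteq> N" by (auto simp: Y_def)
      then have "N = M1 \<or> N = carrier G" using M1 Ns by (auto simp: maximal_subgroup_def)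
      then show False using NM NG by blast
    qed
    then show ?thesis by (auto simp: Y_def)
  qed
  have PYeq: "P = Y"
  proof (rule ccontr)
    assume "P \<noteq> Y"
    then have "P \<subset> Y" using PY by blast
    from deep[OF M1 NM P(1) Ys this YM]
    obtain L where "L \<lhd> G\<lparr>carrier := N\<rparr>" "L \<noteq> N" "P \<inter> N \<subseteq> L" by blast
    then show False using full[of L] PN by blast
  qed
  have cardP1: "card P1 = p"
  proof -
    interpret GP1: group "G\<lparr>carrier := P1\<rparr>" by (rule subgroup_imp_group[OF P1s(1)])
    have "card P1 = p ^ 1 * p ^ (a - 1)" using P1(2) power_minus_mult[of a p] a0 by (simp add: mult.commute)
    then obtain E where E: "subgroup E (G\<lparr>carrier := P1\<rparr>)" "card E = p"
      using sylow_thm[OF p(1) GP1.group_axioms, of 1 "p ^ (a - 1)"] finsub[OF P1s(1)] by (auto simp: order_def)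
    have Es: "subgroup E G" "E \<subseteq> P1"
      using incl_subgroup[OF P1s(1) E(1)] subgroup.subset[OF E(1)] by auto
    \<comment> \<open>If \<open>E\<close> is smaller than \<open>P1\<close>, then \<open>U = E <#> P2\<close> is a proper subgroup of \<open>P = M1 \<inter> N\<close>. The normal
      subgroup \<open>L\<close> of \<open>N\<close> that contains it meets the simple group \<open>S\<close> nontrivially, so it
      contains \<open>S\<close> and \<open>P2\<close>, hence \<open>P\<close>.\<close>
    have "E = P1"
    proof (rule ccontr)
      assume EP: "E \<noteq> P1"
      define U where "U = E <#> P2"
      have U: "subgroup U G" "E \<subseteq> U" "P2 \<subseteq> U" "card U = card E * p ^ b"
        using prod[OF Es] by (auto simp: U_def)
      have UP: "U \<subseteq> P" unfolding U_def P_def by (rule mono_set_mult[OF Es(2)]) simp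
      have "card E < card P1" using EP Es(2) finsub[OF P1s(1)] by (simp add: psubset_card_mono)
      then have "card U < card P" using U(4) P(4) P1(2) p_pos[of b] by (simp add: power_add)
      then have "U \<subset> Y" using UP PYeq by auto
      from deep[OF M1 NM U(1) Ys this YM]
      obtain L where L: "L \<lhd> G\<lparr>carrier := N\<rparr>" "L \<noteq> N" "U \<inter> N \<subseteq> L" by blast
      have UL: "U \<subseteq> L" using L(3) UP PN by blast
      have "L \<inter> S \<lhd> G\<lparr>carrier := S\<rparr>"
        using L(1) Ss subgroups_Inter_pair[of L S] unfolding nrm normal_in_iff[OF Ss(1)] by auto
      then have "L \<inter> S = {\<one>} \<or> L \<inter> S = S" by (rule simple)
      moreover have "L \<inter> S \<noteq> {\<one>}"
      proof
        assume "L \<inter> S = {\<one>}"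
        then have "E \<subseteq> {\<one>}" using Es P1s UL U(2) by blast
        then have "card E \<le> 1" using card_mono[of "{\<one>}" E] by simp
        then show False using E(2) prime_gt_1_nat[OF p(1)] by simp
      qed
      ultimately have "S \<subseteq> L" by blast
      then have "P1 \<subseteq> L" "P2 \<subseteq> L" using P1s U(3) UL by auto
      then have "P \<subseteq> L"
        using L(1) subgroup.m_closed[of L G] unfolding P_def nrm set_mult_def by blast
      then show False using full[OF L(1)] L(2) by blast
    qed
    then show ?thesis using E(2) by simp
  qed
  have P1p: "Factorial_Ring.prime (card P1)" using cardP1 p(1) by simp
  \<comment> \<open>\<open>P1\<close> is its own normalizer in \<open>S\<close>: as \<open>S\<close> centralizes \<open>P2\<close>, an element of \<open>S\<close> that
    normalizes \<open>P1\<close> lies in \<open>T \<inter> N = P\<close>.\<close>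
  have selfn: "g \<in> P1" if g: "g \<in> S" and gP: "\<And>x. x \<in> P1 \<Longrightarrow> g \<otimes> x \<otimes> inv g \<in> P1" for g
  proof -
    have gG: "g \<in> carrier G" using g by simp
    have "g \<otimes> z \<otimes> inv g \<in> P" if z: "z \<in> P" for z
    proof -
      obtain x y where xy: "x \<in> P1" "y \<in> P2" "z = x \<otimes> y" using z by (auto simp: P_def set_mult_def)
      have "g \<otimes> y \<otimes> inv g = y" using com[of g y] g xy P2s conj_fixed_iff[OF gG, of y] by auto
      then have "g \<otimes> z \<otimes> inv g = (g \<otimes> x \<otimes> inv g) \<otimes> y" using conj_mult[OF gG, of x y] xy by simp
      then show ?thesis using gP[OF xy(1)] xy(2) unfolding P_def set_mult_def by blast
    qed
    then have "g \<in> T" using gG by (simp add: Tmem)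
    then have "g \<in> P" using PYeq TM g Ss by (auto simp: Y_def)
    then obtain x y where xy: "x \<in> P1" "y \<in> P2" "g = x \<otimes> y" by (auto simp: P_def set_mult_def)
    then have "inv x \<otimes> g = y" by (simp add: inv_mult_cancel_left)
    then have "y \<in> S" using g xy P1s S.m_closed S.m_inv_closed by blast
    then have "y = \<one>" using tr xy P2s by blast
    then show ?thesis using xy by simp
  qed
  have P1S: "P1 \<noteq> S"
  proof
    assume PS: "P1 = S"
    obtain s where s: "s \<in> S" "s \<noteq> \<one>" using S1 S.one_closed by blast
    have "s \<otimes> n = n \<otimes> s" if n: "n \<in> N" for n
    proof -
      obtain t c where tc: "t \<in> S" "c \<in> C" "n = t \<otimes> c" using n SC by (auto simp: set_mult_def)
      have st: "s \<otimes> t = t \<otimes> s" using prime_card_subgroup_commute[OF P1s(1) P1p] s tc PS by blast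
      have "s \<otimes> n = (s \<otimes> t) \<otimes> c" using tc s by (simp add: m_assoc)
      also have "\<dots> = t \<otimes> (s \<otimes> c)" using tc s st by (simp add: m_assoc)
      also have "\<dots> = n \<otimes> s" using com[OF s(1) tc(2)] tc s by (simp add: m_assoc)
      finally show ?thesis .
    qed
    then show False using Zel[of s] s Ss by blast
  qed
  have "\<exists>K. K \<lhd> G\<lparr>carrier := S\<rparr> \<and> K \<noteq> {\<one>\<^bsub>G\<lparr>carrier := S\<rparr>\<^esub>} \<and> K \<noteq> carrier (G\<lparr>carrier := S\<rparr>)"
  proof (rule GS.abelian_TI_subgroup_imp_normal_subgroup[OF _ P1(1)])
    show "finite (carrier (G\<lparr>carrier := S\<rparr>))" using finsub[OF Ss(1)] by simp
    show "P1 \<noteq> {\<one>\<^bsub>G\<lparr>carrier := S\<rparr>\<^esub>}" using cardP1 p(1) by auto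
    show "P1 \<noteq> carrier (G\<lparr>carrier := S\<rparr>)" using P1S by simp
    show "a \<otimes>\<^bsub>G\<lparr>carrier := S\<rparr>\<^esub> b = b \<otimes>\<^bsub>G\<lparr>carrier := S\<rparr>\<^esub> a" if "a \<in> P1" "b \<in> P1" for a b
      using prime_card_subgroup_commute[OF P1s(1) P1p that] by simp
    show "a = \<one>\<^bsub>G\<lparr>carrier := S\<rparr>\<^esub>" if g: "g \<in> carrier (G\<lparr>carrier := S\<rparr>) - P1" and a: "a \<in> P1"
      and ga: "g \<otimes>\<^bsub>G\<lparr>carrier := S\<rparr>\<^esub> a \<otimes>\<^bsub>G\<lparr>carrier := S\<rparr>\<^esub> inv\<^bsub>G\<lparr>carrier := S\<rparr>\<^esub> g \<in> P1" for g a
    proof (rule ccontr)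
      assume "a \<noteq> \<one>\<^bsub>G\<lparr>carrier := S\<rparr>\<^esub>"
      then have a1: "a \<noteq> \<one>" by simp
      have gS: "g \<in> S" using g by simp
      have "g \<otimes> a \<otimes> inv g \<in> P1" using ga m_inv_consistent[OF Ss(1) gS] by simp
      then have "g \<otimes> x \<otimes> inv g \<in> P1" if "x \<in> P1" for x
        using prime_card_subgroup_conj[OF P1s(1) P1p _ a a1 _ that] gS by simp
      then show False using selfn[OF gS] g by simp
    qed
  qed
  then show False using simple by auto
qed

text \<open>Both cases together. The hypothesis on chains is what the trace lemma below extracts from
  \<open>K\<close>-\<open>\<FF>\<close>-subnormality: it speaks of the bottom of the chain only, which has the smallest trace
  on \<open>N\<close>.\<close>

lemma (in group) minimal_normal_abelian:
  assumes fin: "finite (carrier G)" and N: "chief_factor G N {\<one>}"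
    and chains: "\<And>M. maximal_chain G 3 M \<Longrightarrow> \<not> N \<subseteq> M 1 \<Longrightarrow>
      \<exists>L. L \<lhd> G\<lparr>carrier := N\<rparr> \<and> L \<noteq> N \<and> M 3 \<inter> N \<subseteq> L"
    and xy: "x \<in> N" "y \<in> N"
  shows "x \<otimes> y = y \<otimes> x"
proof -
  have deep: "\<exists>L. L \<lhd> G\<lparr>carrier := N\<rparr> \<and> L \<noteq> N \<and> U \<inter> N \<subseteq> L"
    if h: "maximal_subgroup G M1" "\<not> N \<subseteq> M1" "subgroup U G" "subgroup Y G" "U \<subset> Y" "Y \<subset> M1" for M1 U Y
  proof -
    obtain M where M: "maximal_chain G 3 M" "M 1 = M1" "U \<subseteq> M 3"
      using maximal_chain_through[OF fin h(1,3-6)] by blast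
    have "\<not> N \<subseteq> M 1" using h(2) M(2) by simp
    from chains[OF M(1) this] show ?thesis using M(3) by (meson Int_mono order_refl subset_trans)
  qed
  have Nn: "N \<lhd> G" and N1: "{\<one>} \<subset> N" and min: "\<And>L. L \<lhd> G \<Longrightarrow> {\<one>} \<subset> L \<Longrightarrow> L \<subset> N \<Longrightarrow> False"
    using N by (auto simp: chief_factor_def)
  show ?thesis
  proof (cases "N = carrier G")
    case False
    show ?thesis by (rule proper_minimal_normal_abelian[OF fin N False _ xy]) (rule deep)
  next
    case True
    have simple: "L = {\<one>} \<or> L = carrier G" if L: "L \<lhd> G" for L
    proof -
      have "\<one> \<in> L" "L \<subseteq> carrier G"
        using normal_imp_subgroup[OF L] subgroup.one_closed subgroup.subset by blast+
      then show ?thesis using min[OF L] True by blast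
    qed
    show ?thesis
    proof (rule simple_no_long_chain_imp_commute[OF fin simple])
      fix A B C assume s: "subgroup A G" "subgroup B G" "subgroup C G"
        and c: "A \<noteq> {\<one>}" "A \<subset> B" "B \<subset> C" "C \<subset> carrier G"
      obtain M1 where M1: "maximal_subgroup (G\<lparr>carrier := carrier G\<rparr>) M1" "C \<subseteq> M1"
        using exists_maximal_above[OF fin s(3) subgroup_self c(4)] by blast
      then have M: "maximal_subgroup G M1" by simp
      then have "\<not> N \<subseteq> M1" using True subgroup.subset[of M1 G] by (auto simp: maximal_subgroup_def)
      moreover have "B \<subset> M1" using c(3) M1(2) by blast
      ultimately obtain L where L: "L \<lhd> G\<lparr>carrier := N\<rparr>" "L \<noteq> N" "A \<inter> N \<subseteq> L"
        using deep[OF M _ s(1,2) c(2)] by meson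
      then have "L = {\<one>}" using simple[of L] True by simp
      then show False using L(3) True subgroup.subset[OF s(1)] subgroup.one_closed[OF s(1)] c(1) by blast
    qed (use xy True in auto)
  qed
qed

section \<open>Traces of K-F-subnormal subgroups\<close>

lemma (in normal) order_FactGroup_mult_card: "order (G Mod H) * card H = order G"
  using lagrange[OF subgroup_axioms] by (simp add: order_def FactGroup_def)

text \<open>By the second isomorphism theorem \<open>H / (N \<inter> H)\<close> is isomorphic to a subgroup of \<open>G / N\<close>.\<close>

lemma (in group) index_Int_normal_dvd:
  assumes fin: "finite (carrier G)" and N: "N \<lhd> G" and H: "subgroup H G"
  obtains m where "card H = m * card (N \<inter> H)" "m dvd order (G Mod N)"
proof -
  interpret N: normal N G by (rule N)
  interpret iso: second_isomorphism_grp N G H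
    by (intro second_isomorphism_grp.intro N second_isomorphism_grp_axioms.intro H)
  interpret GH: group "G\<lparr>carrier := H\<rparr>" by (rule subgroup_imp_group[OF H])
  have W: "subgroup (N <#> H) G" "N \<subseteq> N <#> H"
    by (rule iso.normal_set_mult_subgroup iso.H_contained_in_set_mult)+
  have NH: "N \<inter> H \<lhd> G\<lparr>carrier := H\<rparr>" by (rule normal_Int_subgroup[OF H N])
  have NW: "N \<lhd> G\<lparr>carrier := N <#> H\<rparr>" by (rule normal_restrict_supergroup[OF W(1) N W(2)])
  define m where "m = order (G\<lparr>carrier := H\<rparr> Mod (N \<inter> H))"
  have m: "m = order (G\<lparr>carrier := N <#> H\<rparr> Mod N)"
    unfolding m_def using iso.normal_intersection_quotient_isom by (intro iso_same_order)
  have c1: "card H = m * card (N \<inter> H)"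
    using normal.order_FactGroup_mult_card[OF NH] by (simp add: m_def order_def)
  have c2: "m * card N = card (N <#> H)"
    using normal.order_FactGroup_mult_card[OF NW] by (simp add: m order_def)
  have "m * card N dvd order (G Mod N) * card N"
    using card_subgroup_dvd[OF W(1) subgroup_self subgroup.subset[OF W(1)]] N.order_FactGroup_mult_card c2
    by (simp add: order_def)
  moreover have "card N \<noteq> 0" using N.finite_imp_card_positive[OF fin] by simp
  ultimately have "m dvd order (G Mod N)" by simp
  then show ?thesis using that c1 by blast
qed

text \<open>All that is used of \<open>K\<close>-\<open>\<FF>\<close>-subnormality. In a chain from \<open>A\<close> to \<open>G\<close>, consider the step
  from a subgroup \<open>B\<close> without \<open>H\<close> to a subgroup \<open>D\<close> above \<open>H\<close>. If \<open>B\<close> is normal in \<open>D\<close>, then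
  \<open>B \<inter> H\<close> is the required subgroup. A \<open>\<pi>'\<close>-quotient cannot occur at this step, since its kernel would
  cut out a proper normal subgroup of \<open>H\<close> of index prime to \<open>p\<close>.\<close>

lemma (in group) K_subnormal_trace:
  assumes fin: "finite (carrier G)" and HK: "chief_factor G H K"
    and p: "Factorial_Ring.prime p" "p \<in> \<pi>" and n: "card H = n * card K" "p dvd n"
    and A: "K_subnormal (pi_prime_groups \<pi>) G A" and KA: "K \<subseteq> A" and HA: "\<not> H \<subseteq> A"
  shows "\<exists>L. L \<lhd> G\<lparr>carrier := H\<rparr> \<and> K \<subseteq> L \<and> L \<noteq> H \<and> A \<inter> H \<subseteq> L"
proof -
  have HG: "H \<lhd> G" and KG: "K \<lhd> G" and KH: "K \<subset> H" using HK by (auto simp: chief_factor_def)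
  interpret H: normal H G by (rule HG)
  interpret K: normal K G by (rule KG)
  have Hs: "subgroup H G" by (rule H.subgroup_axioms)
  obtain l :: nat and C where C: "C 0 = A" "C l = carrier G" "\<And>i. i \<le> l \<Longrightarrow> subgroup (C i) G"
    "\<And>i. i < l \<Longrightarrow> C i \<subseteq> C (Suc i)"
    "\<And>i. i < l \<Longrightarrow> C i \<lhd> G\<lparr>carrier := C (Suc i)\<rparr> \<or>
      G\<lparr>carrier := C (Suc i)\<rparr> Mod normal_core (G\<lparr>carrier := C (Suc i)\<rparr>) (C i) \<in> pi_prime_groups \<pi>"
    using A unfolding K_subnormal_def by metis
  \<comment> \<open>The chain leaves \<open>H\<close> behind in its step from \<open>B = C i\<close>, which does not contain \<open>H\<close>, to
    \<open>D = C (i + 1)\<close>, which does.\<close>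
  define j where "j = (LEAST j. H \<subseteq> C j)"
  have Hl: "H \<subseteq> C l" using C(2) H.subset by simp
  have Hj: "H \<subseteq> C j" unfolding j_def by (rule LeastI[of _ l]) (rule Hl)
  have jl: "j \<le> l" unfolding j_def by (rule Least_le) (rule Hl)
  have "j \<noteq> 0" using Hj HA C(1) by (metis)
  then obtain i where i: "j = Suc i" using not0_implies_Suc by blast
  have Hi: "\<not> H \<subseteq> C i" using not_less_Least[of i "\<lambda>j. H \<subseteq> C j"] i by (simp add: j_def)
  have il: "i < l" using i jl by simp
  have up: "A \<subseteq> C k" if "k \<le> l" for k
    using that by (induction k) (use C(1,4) in \<open>auto simp: Suc_le_eq\<close>)
  define B where "B = C i"
  define D where "D = C (Suc i)"
  have Bs: "subgroup B G" and Ds: "subgroup D G" and BD: "B \<subseteq> D" and HD: "H \<subseteq> D"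
    using C(3)[of i] C(3)[of "Suc i"] C(4)[OF il] il Hj i by (auto simp: B_def D_def)
  have AB: "A \<subseteq> B" using up[of i] il by (simp add: B_def)
  have HB: "\<not> H \<subseteq> B" using Hi by (simp add: B_def)
  interpret GD: group "G\<lparr>carrier := D\<rparr>" by (rule subgroup_imp_group[OF Ds])
  consider (n) "B \<lhd> G\<lparr>carrier := D\<rparr>"
    | (q) "G\<lparr>carrier := D\<rparr> Mod normal_core (G\<lparr>carrier := D\<rparr>) B \<in> pi_prime_groups \<pi>"
    using C(5)[OF il] by (auto simp: B_def D_def)
  then show ?thesis
  proof cases
    case n
    note b = n[unfolded normal_in_iff[OF Ds]]
    have "x \<otimes> z \<otimes> inv x \<in> B \<inter> H" if "x \<in> H" "z \<in> B \<inter> H" for x z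
      using b that HD H.inv_op_closed2[of x z] by blast
    then have "B \<inter> H \<lhd> G\<lparr>carrier := H\<rparr>"
      using subgroups_Inter_pair[OF Bs Hs] unfolding normal_in_iff[OF Hs] by blast
    moreover have "K \<subseteq> B \<inter> H" "B \<inter> H \<noteq> H" "A \<inter> H \<subseteq> B \<inter> H" using KA AB KH HB by blast+
    ultimately show ?thesis by blast
  next
    \<comment> \<open>This case is contradictory: the trace on \<open>H\<close> of the core \<open>R\<close> of \<open>B\<close> has an index prime to \<open>p\<close>,
      so it is all of \<open>H\<close>, but \<open>B\<close> does not contain \<open>H\<close>.\<close>
    case q
    define R where "R = normal_core (G\<lparr>carrier := D\<rparr>) B"
    have BsD: "subgroup B (G\<lparr>carrier := D\<rparr>)" by (rule subgroup_incl[OF Bs Ds BD])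
    have R: "R \<lhd> G\<lparr>carrier := D\<rparr>" "R \<subseteq> B" "\<And>N. N \<lhd> G\<lparr>carrier := D\<rparr> \<Longrightarrow> N \<subseteq> B \<Longrightarrow> N \<subseteq> R"
      unfolding R_def using GD.normal_core_greatest[OF BsD] by blast+
    have KD: "K \<lhd> G\<lparr>carrier := D\<rparr>" by (rule normal_restrict_supergroup[OF Ds KG]) (use KH HD in blast)
    have KR: "K \<subseteq> R" by (rule R(3)[OF KD]) (use KA AB in blast)
    have finD: "finite (carrier (G\<lparr>carrier := D\<rparr>))"
      using fin subgroup.subset[OF Ds] by (simp add: finite_subset)
    obtain m where m: "card H = m * card (R \<inter> H)" "m dvd order (G\<lparr>carrier := D\<rparr> Mod R)"
      using GD.index_Int_normal_dvd[OF finD R(1) subgroup_incl[OF Hs Ds HD]] by blast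
    have "\<not> p dvd order (G\<lparr>carrier := D\<rparr> Mod R)"
      using q p by (simp add: pi_prime_groups_def R_def)
    then have pm: "\<not> p dvd m" using m(2) dvd_trans by blast
    have "R \<inter> H \<lhd> G\<lparr>carrier := H\<rparr>"
      using GD.normal_Int_subgroup[OF subgroup_incl[OF Hs Ds HD] R(1)] by simp
    then have "R \<inter> H = H"
      using chief_factor_normal_prime_index[OF fin HK p(1) n, of "R \<inter> H" m] KR KH m(1) pm by blast
    then show ?thesis using R(2) HB by blast
  qed
qed

section \<open>Passage to a quotient\<close>

lemma (in group_hom) subgroup_vimage:
  assumes B: "subgroup B H"
  shows "subgroup {x \<in> carrier G. h x \<in> B} G"
proof -
  interpret B: subgroup B H by (rule B)
  show ?thesis
  proof (rule G.subgroupI)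
    have "\<one> \<in> {x \<in> carrier G. h x \<in> B}" by simp
    then show "{x \<in> carrier G. h x \<in> B} \<noteq> {}" by blast
  qed auto
qed

lemma (in group_hom) vimage_image_subgroup:
  assumes L: "subgroup L G" and ker: "kernel G H h \<subseteq> L"
  shows "{x \<in> carrier G. h x \<in> h ` L} = L"
proof
  show "{x \<in> carrier G. h x \<in> h ` L} \<subseteq> L"
  proof
    fix x assume "x \<in> {x \<in> carrier G. h x \<in> h ` L}"
    then obtain y where x: "x \<in> carrier G" and y: "y \<in> L" "h x = h y" by auto
    have yG: "y \<in> carrier G" using y subgroup.mem_carrier[OF L] by simp
    then have "x \<otimes> inv y \<in> kernel G H h" using x y by (simp add: kernel_def)
    then have "x \<otimes> inv y \<otimes> y \<in> L" using ker subgroup.m_closed[OF L] y(1) by blast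
    then show "x \<in> L" using x yG by (simp add: G.m_assoc)
  qed
qed (use subgroup.mem_carrier[OF L] in auto)

lemma (in group_hom) maximal_chain_vimage:
  assumes surj: "h ` carrier G = carrier H" and M: "maximal_chain H n M"
  shows "maximal_chain G n (\<lambda>i. {x \<in> carrier G. h x \<in> M i})"
proof -
  have Ms: "subgroup (M i) H" if "i \<le> n" for i
    using that
  proof (induction i)
    case 0
    then show ?case using M H.subgroup_self by (simp add: maximal_chain_def)
  next
    case (Suc i)
    then have "maximal_subgroup (H\<lparr>carrier := M i\<rparr>) (M (Suc i))"
      using M unfolding maximal_chain_def by (metis One_nat_def Suc_le_mono atLeastAtMost_iff diff_Suc_1 le0)
    then show ?case using Suc H.maximal_in_iff[of "M i"] by simp
  qed
  have "maximal_subgroup (G\<lparr>carrier := {x \<in> carrier G. h x \<in> M (i - 1)}\<rparr>) {x \<in> carrier G. h x \<in> M i}"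
    if i: "i \<in> {1..n}" for i
  proof -
    have Bs: "subgroup (M (i - 1)) H" and As: "subgroup (M i) H" using Ms i by auto
    have "maximal_subgroup (H\<lparr>carrier := M (i - 1)\<rparr>) (M i)" using M i by (simp add: maximal_chain_def)
    then have AB: "M i \<subset> M (i - 1)"
      and max: "\<And>L. subgroup L H \<Longrightarrow> M i \<subseteq> L \<Longrightarrow> L \<subseteq> M (i - 1) \<Longrightarrow> L = M i \<or> L = M (i - 1)"
      unfolding H.maximal_in_iff[OF Bs] by blast+
    have pre: "\<exists>x\<in>carrier G. y = h x" if "y \<in> carrier H" for y using that surj by blast
    have "{x \<in> carrier G. h x \<in> M i} \<subset> {x \<in> carrier G. h x \<in> M (i - 1)}"
    proof -
      obtain y where y: "y \<in> M (i - 1)" "y \<notin> M i" using AB by blast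
      obtain x where "x \<in> carrier G" "y = h x" using pre[OF subgroup.mem_carrier[OF Bs y(1)]] by auto
      then show ?thesis using y AB by auto
    qed
    moreover have "L = {x \<in> carrier G. h x \<in> M i} \<or> L = {x \<in> carrier G. h x \<in> M (i - 1)}"
      if L: "subgroup L G" "{x \<in> carrier G. h x \<in> M i} \<subseteq> L" "L \<subseteq> {x \<in> carrier G. h x \<in> M (i - 1)}" for L
    proof -
      have "kernel G H h \<subseteq> L" using L(2) subgroup.one_closed[OF As] by (auto simp: kernel_def)
      then have Leq: "{x \<in> carrier G. h x \<in> h ` L} = L" by (rule vimage_image_subgroup[OF L(1)])
      have "M i \<subseteq> h ` L"
      proof
        fix y assume y: "y \<in> M i"
        obtain x where "x \<in> carrier G" "y = h x" using pre[OF subgroup.mem_carrier[OF As y]] by auto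
        then show "y \<in> h ` L" using L(2) y by auto
      qed
      moreover have "h ` L \<subseteq> M (i - 1)" using L(3) by blast
      ultimately have "h ` L = M i \<or> h ` L = M (i - 1)"
        by (intro max subgroup_img_is_subgroup[OF L(1)])
      then show ?thesis using Leq by auto
    qed
    ultimately show ?thesis
      unfolding G.maximal_in_iff[OF subgroup_vimage[OF Bs]] using subgroup_vimage[OF As] by blast
  qed
  then show ?thesis using M by (auto simp: maximal_chain_def)
qed

lemma (in group_hom) normal_image:
  assumes B: "subgroup B G" and L: "L \<lhd> G\<lparr>carrier := B\<rparr>"
  shows "h ` L \<lhd> H\<lparr>carrier := h ` B\<rparr>"
proof -
  note l = L[unfolded G.normal_in_iff[OF B]]
  have LG: "x \<in> L \<Longrightarrow> x \<in> carrier G" for x using subgroup.subset[of L G] l by blast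
  have BG: "x \<in> B \<Longrightarrow> x \<in> carrier G" for x by (rule subgroup.mem_carrier[OF B])
  have "h x \<otimes>\<^bsub>H\<^esub> h y \<otimes>\<^bsub>H\<^esub> inv\<^bsub>H\<^esub> h x = h (x \<otimes> y \<otimes> inv x)" if "x \<in> B" "y \<in> L" for x y
    using LG[OF that(2)] BG[OF that(1)] by simp
  then show ?thesis
    unfolding H.normal_in_iff[OF subgroup_img_is_subgroup[OF B]]
    using l subgroup_img_is_subgroup[of L] by auto
qed

lemma (in group_hom) chief_factor_image:
  assumes surj: "h ` carrier G = carrier H" and N: "chief_factor G N (kernel G H h)"
  shows "chief_factor H (h ` N) {\<one>\<^bsub>H\<^esub>}"
proof -
  have NG: "N \<lhd> G" and KN: "kernel G H h \<subset> N"
    and min: "\<And>L. L \<lhd> G \<Longrightarrow> kernel G H h \<subset> L \<Longrightarrow> L \<subset> N \<Longrightarrow> False"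
    using N by (auto simp: chief_factor_def)
  have Ns: "subgroup N G" by (rule normal_imp_subgroup[OF NG])
  have "h ` N \<lhd> H\<lparr>carrier := h ` carrier G\<rparr>"
    by (rule normal_image[OF G.subgroup_self]) (simp add: NG)
  then have hN: "h ` N \<lhd> H" using surj by simp
  have Neq: "{x \<in> carrier G. h x \<in> h ` N} = N" by (rule vimage_image_subgroup[OF Ns]) (use KN in blast)
  have ne: "h ` N \<noteq> {\<one>\<^bsub>H\<^esub>}"
  proof
    assume "h ` N = {\<one>\<^bsub>H\<^esub>}"
    then have "N \<subseteq> kernel G H h" using Neq by (auto simp: kernel_def)
    then show False using KN by blast
  qed
  have minH: "False" if L: "L \<lhd> H" "{\<one>\<^bsub>H\<^esub>} \<subset> L" "L \<subset> h ` N" for L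
  proof -
    have Ls: "subgroup L H" by (rule normal_imp_subgroup[OF L(1)])
    define V where "V = {x \<in> carrier G. h x \<in> L}"
    have Vs: "subgroup V G" unfolding V_def by (rule subgroup_vimage[OF Ls])
    have "V \<lhd> G"
      by (rule G.normal_invI[OF Vs]) (use normal.inv_op_closed2[OF L(1)] in \<open>auto simp: V_def\<close>)
    moreover have "kernel G H h \<subset> V"
    proof -
      obtain y where y: "y \<in> L" "y \<noteq> \<one>\<^bsub>H\<^esub>" using L(2) by blast
      have "y \<in> h ` carrier G" using subgroup.mem_carrier[OF Ls y(1)] surj by simp
      then obtain x where "x \<in> carrier G" "h x = y" by auto
      then have "x \<in> V" "x \<notin> kernel G H h" using y by (auto simp: V_def kernel_def)
      moreover have "kernel G H h \<subseteq> V" using L(2) by (auto simp: V_def kernel_def)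
      ultimately show ?thesis by blast
    qed
    moreover have "V \<subset> N"
    proof -
      have "\<not> h ` N \<subseteq> L" using L(3) by (simp add: less_le_not_le)
      then obtain x where "x \<in> N" "h x \<notin> L" by auto
      then have "x \<in> N" "x \<notin> V" by (simp_all add: V_def)
      moreover have "V \<subseteq> {x \<in> carrier G. h x \<in> h ` N}" using psubset_imp_subset[OF L(3)] unfolding V_def by blast
      ultimately show ?thesis unfolding Neq by auto
    qed
    ultimately show False by (rule min)
  qed
  have "{\<one>\<^bsub>H\<^esub>} \<subset> h ` N"
    using ne subgroup.one_closed[OF normal_imp_subgroup[OF hN]] by auto
  then show ?thesis
    unfolding chief_factor_def using minH by (intro conjI hN H.one_is_normal notI) auto
qed

section \<open>Chain conditions and solubility\<close>

theorem corollary1p6: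
  fixes G :: "('a, 'b) monoid_scheme" and \<pi> :: "nat set"
  assumes "\<pi> \<noteq> {}" and "\<forall>p\<in>\<pi>. Factorial_Ring.prime p"
    and "group G" and "finite (carrier G)"
    and "\<And>M. maximal_chain G 3 M \<Longrightarrow>
           \<exists>i\<in>{1..3}. K_subnormal (pi_prime_groups \<pi>) G (M i)"
  shows "pi_soluble \<pi> G"
  unfolding pi_soluble_def
proof (intro allI impI)
  fix H K assume HK: "chief_factor G H K"
  interpret group G by fact
  note fin = assms(4)
  have HG: "H \<lhd> G" and KG: "K \<lhd> G" and KH: "K \<subset> H" using HK by (auto simp: chief_factor_def)
  interpret K: normal K G by (rule KG)
  interpret Q: group "G Mod K" by (rule K.factorgroup_is_group)
  have Hs: "subgroup H G" by (rule normal_imp_subgroup[OF HG])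
  have KnH: "K \<lhd> G\<lparr>carrier := H\<rparr>" by (rule normal_restrict_supergroup[OF Hs KG]) (use KH in blast)
  define h where "h = (\<lambda>x. K #>\<^bsub>G\<^esub> x)"
  interpret h: group_hom G "G Mod K" h
    unfolding h_def by (intro group_hom.intro group_axioms Q.group_axioms group_hom_axioms.intro K.r_coset_hom_Mod)
  have surj: "h ` carrier G = carrier (G Mod K)" by (simp add: h_def carrier_FactGroup)
  have ker: "kernel G (G Mod K) h = K"
  proof
    show "kernel G (G Mod K) h \<subseteq> K"
      using rcos_self[OF _ K.subgroup_axioms] by (auto simp: kernel_def h_def)
    show "K \<subseteq> kernel G (G Mod K) h"
      using K.rcos_const[OF is_group] by (auto simp: kernel_def h_def)
  qed
  define N where "N = h ` H"
  have Nchief: "chief_factor (G Mod K) N {\<one>\<^bsub>G Mod K\<^esub>}"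
    unfolding N_def by (rule h.chief_factor_image[OF surj]) (simp add: ker HK)
  have finQ: "finite (carrier (G Mod K))" using surj fin by (metis finite_imageI)
  have Fcar: "carrier (G\<lparr>carrier := H\<rparr> Mod K) = N"
    by (simp add: carrier_FactGroup N_def h_def)
  have Fgrp: "group (G\<lparr>carrier := H\<rparr> Mod K)" by (rule normal.factorgroup_is_group[OF KnH])
  have Ford: "order (G\<lparr>carrier := H\<rparr> Mod K) = card N" by (simp add: order_def Fcar)
  have cardH: "card H = card N * card K"
    using normal.order_FactGroup_mult_card[OF KnH] Ford by (simp add: order_def)
  show "(\<exists>p\<in>\<pi>. is_p_group p (G\<lparr>carrier := H\<rparr> Mod K)) \<or> G\<lparr>carrier := H\<rparr> Mod K \<in> pi_prime_groups \<pi>"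
  proof (cases "\<exists>p\<in>\<pi>. p dvd card N")
    case False
    moreover have "finite N" unfolding N_def using fin subgroup.subset[OF Hs] finite_subset by blast
    ultimately show ?thesis using Fgrp by (auto simp: pi_prime_groups_def Ford Fcar)
  next
    case True
    then obtain p where p: "p \<in> \<pi>" "Factorial_Ring.prime p" "p dvd card N" using assms(2) by blast
    have comm: "x \<otimes>\<^bsub>G Mod K\<^esub> y = y \<otimes>\<^bsub>G Mod K\<^esub> x" if xy: "x \<in> N" "y \<in> N" for x y
    proof (rule Q.minimal_normal_abelian[OF finQ Nchief _ xy])
      fix M assume M: "maximal_chain (G Mod K) 3 M" and NM: "\<not> N \<subseteq> M 1"
      define M' where "M' = (\<lambda>i. {x \<in> carrier G. h x \<in> M i})"
      have "maximal_chain G 3 M'" unfolding M'_def by (rule h.maximal_chain_vimage[OF surj M])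
      then obtain i where i: "i \<in> {1..3}" and A: "K_subnormal (pi_prime_groups \<pi>) G (M' i)"
        using assms(5) by blast
      have M3i: "M 3 \<subseteq> M i" and Mi1: "M i \<subseteq> M 1" using maximal_chain_antimono[OF M] i by auto
      have "\<not> H \<subseteq> M' i"
      proof
        assume "H \<subseteq> M' i"
        then have "N \<subseteq> M i" by (auto simp: M'_def N_def)
        then show False using NM Mi1 by blast
      qed
      moreover have "K \<subseteq> M' i"
      proof -
        have "subgroup (M' i) G"
          using A[unfolded K_subnormal_def] by (metis le0)
        then have "\<one>\<^bsub>G\<^esub> \<in> M' i" by (rule subgroup.one_closed)
        then have "\<one>\<^bsub>G Mod K\<^esub> \<in> M i" by (auto simp: M'_def simp del: one_FactGroup)
        moreover have "h x = \<one>\<^bsub>G Mod K\<^esub>" "x \<in> carrier G" if "x \<in> K" for x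
          using that ker by (auto simp: kernel_def simp del: one_FactGroup)
        ultimately show ?thesis by (auto simp: M'_def simp del: one_FactGroup)
      qed
      ultimately obtain L where L: "L \<lhd> G\<lparr>carrier := H\<rparr>" "K \<subseteq> L" "L \<noteq> H" "M' i \<inter> H \<subseteq> L"
        using K_subnormal_trace[OF fin HK p(2,1) cardH p(3) A] by blast
      have Ls: "subgroup L G" "L \<subseteq> H" using L(1) by (auto simp: normal_in_iff[OF Hs])
      have "h ` L \<lhd> (G Mod K)\<lparr>carrier := N\<rparr>" unfolding N_def by (rule h.normal_image[OF Hs L(1)])
      moreover have "h ` L \<noteq> N"
      proof
        assume "h ` L = N"
        then have "H \<subseteq> {x \<in> carrier G. h x \<in> h ` L}" using subgroup.subset[OF Hs] by (auto simp: N_def)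
        then have "H \<subseteq> L" using h.vimage_image_subgroup[OF Ls(1)] ker L(2) by simp
        then show False using Ls(2) L(3) by blast
      qed
      moreover have "M 3 \<inter> N \<subseteq> h ` L"
      proof
        fix y assume y: "y \<in> M 3 \<inter> N"
        then obtain x where x: "x \<in> H" "y = h x" by (auto simp: N_def)
        then have "x \<in> M' i \<inter> H" using y M3i subgroup.mem_carrier[OF Hs] by (auto simp: M'_def)
        then show "y \<in> h ` L" using L(4) x by blast
      qed
      ultimately show "\<exists>L. L \<lhd> (G Mod K)\<lparr>carrier := N\<rparr> \<and> L \<noteq> N \<and> M 3 \<inter> N \<subseteq> L" by blast
    qed
    have "\<exists>k. card N = p ^ k"
      by (rule Q.chief_factor_prime_dvd_imp_prime_power[OF finQ Nchief _ p(2,3)]) (rule comm)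
    then have "is_p_group p (G\<lparr>carrier := H\<rparr> Mod K)" using Fgrp by (simp add: is_p_group_def Ford)
    then show ?thesis using p(1) by blast
  qed
qed

end
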